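(* Let $w$ be a multilinear commutator word. Then $w$ is strongly concise in the class of all profinite groups; that is, for every profinite group $G$ such that $\lvert G_w\rvert < 2^{\aleph_0}$, the verbal subgroup $w(G)$ is finite.
   Context: A group word $w=w(x_1,\ldots,x_r)$ is an element of the free group on $x_1,\ldots,x_r$. For a profinite group $G$, $G_w=\{w(g_1,\ldots,g_r)\mid g_1,\ldots,g_r\in G\}$ is the set of $w$-values in $G$, and $w(G)$ is the closed subgroup of $G$ generated by $G_w$. A multilinear commutator word (also called outer-commutator word) is a word obtained by nesting commutators and using each variable only once: a single variable is a multilinear commutator word, and if $u,v$ are multilinear commutator words in disjoint sets of variables, then $[u,v]$ is a multilinear commutator word. *)

theory Defs
  imports "HOL-Algebra.Group" "HOL-Analysis.Analysis"
begin

section \<open>Free groups and group words\<close>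

text \<open>The letter \<open>(i, True)\<close> stands for the generator \<open>x\<^sub>i\<close> and \<open>(i, False)\<close> for its inverse.
  The free group on \<open>{x\<^sub>i | i \<in> X}\<close> is realised as the set of reduced words in these letters.\<close>

type_synonym letter = "nat \<times> bool"

definition inv_letter :: "letter \<Rightarrow> letter" where
  "inv_letter l = (fst l, \<not> snd l)"

definition reduced_word :: "letter list \<Rightarrow> bool" where
  "reduced_word w \<longleftrightarrow> successively (\<lambda>l m. m \<noteq> inv_letter l) w"

fun cons_red :: "letter \<Rightarrow> letter list \<Rightarrow> letter list" where
  "cons_red l [] = [l]"
| "cons_red l (m # w) = (if m = inv_letter l then w else l # m # w)"

definition free_group :: "nat set \<Rightarrow> letter list monoid" where
  "free_group X = \<lparr>carrier = {w. reduced_word w \<and> fst ` set w \<subseteq> X},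
     monoid.mult = foldr cons_red, one = []\<rparr>"

text \<open>The value \<open>w(g\<^sub>1, \<dots>, g\<^sub>r)\<close>.\<close>

definition word_eval :: "('a, 'm) monoid_scheme \<Rightarrow> (nat \<Rightarrow> 'a) \<Rightarrow> letter list \<Rightarrow> 'a" where
  "word_eval G g w =
     foldr (\<lambda>(i, s) a. (if s then g i else inv\<^bsub>G\<^esub> g i) \<otimes>\<^bsub>G\<^esub> a) w \<one>\<^bsub>G\<^esub>"

text \<open>The convention is \<open>[a, b] = a\<inverse> b\<inverse> a b\<close>.\<close>

definition commutator :: "('a, 'm) monoid_scheme \<Rightarrow> 'a \<Rightarrow> 'a \<Rightarrow> 'a" where
  "commutator G a b = inv\<^bsub>G\<^esub> a \<otimes>\<^bsub>G\<^esub> inv\<^bsub>G\<^esub> b \<otimes>\<^bsub>G\<^esub> a \<otimes>\<^bsub>G\<^esub> b"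

text \<open>Since elements of the free group are reduced words, \<open>fst ` set u\<close> is the set of indices of
  the variables on which \<open>u\<close> depends.\<close>

inductive multilinear_commutator_word :: "letter list \<Rightarrow> bool" where
  variable: "multilinear_commutator_word [(i, True)]"
| commutator: "multilinear_commutator_word (commutator (free_group UNIV) u v)"
    if "multilinear_commutator_word u" "multilinear_commutator_word v"
      "fst ` set u \<inter> fst ` set v = {}"


section \<open>Profinite groups and verbal subgroups\<close>

locale topological_group = group G for G (structure) +
  fixes T :: "'a topology"
  assumes topspace_eq_carrier: "topspace T = carrier G"
    and continuous_mult: "continuous_map (prod_topology T T) T (\<lambda>(x, y). x \<otimes> y)"
    and continuous_inv: "continuous_map T T (\<lambda>x. inv x)"

definition totally_disconnected_space :: "'a topology \<Rightarrow> bool" where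
  "totally_disconnected_space T \<longleftrightarrow> (\<forall>S. connectedin T S \<longrightarrow> (\<exists>a. S \<subseteq> {a}))"

locale profinite_group = topological_group +
  assumes compact: "compact_space T"
    and Hausdorff: "Hausdorff_space T"
    and totally_disconnected: "totally_disconnected_space T"

text \<open>In the following, \<open>w\<close> is a word in the variables \<open>x\<^sub>1, \<dots>, x\<^sub>r\<close>.\<close>

definition word_values :: "('a, 'm) monoid_scheme \<Rightarrow> nat \<Rightarrow> letter list \<Rightarrow> 'a set" where
  "word_values G r w = {word_eval G g w | g. g \<in> {1..r} \<rightarrow> carrier G}"

definition closed_subgroup_generated ::
    "('a, 'm) monoid_scheme \<Rightarrow> 'a topology \<Rightarrow> 'a set \<Rightarrow> 'a set" where
  "closed_subgroup_generated G T A = \<Inter>{H. subgroup H G \<and> closedin T H \<and> A \<subseteq> H}"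

definition verbal_subgroup ::
    "('a, 'm) monoid_scheme \<Rightarrow> 'a topology \<Rightarrow> nat \<Rightarrow> letter list \<Rightarrow> 'a set" where
  "verbal_subgroup G T r w = closed_subgroup_generated G T (word_values G r w)"


section \<open>Basic facts: free groups are groups, and evaluation is a homomorphism\<close>

lemma inv_letter_inv_letter [simp]: "inv_letter (inv_letter l) = l"
  by (simp add: inv_letter_def)

lemma fst_inv_letter [simp]: "fst (inv_letter l) = fst l"
  by (simp add: inv_letter_def)

lemma inv_letter_neq [simp]: "inv_letter l \<noteq> l" "l \<noteq> inv_letter l"
  by (auto simp: inv_letter_def prod_eq_iff)

lemma reduced_Nil [simp]: "reduced_word []"
  by (simp add: reduced_word_def)

lemma reduced_ConsD: "reduced_word (l # w) \<Longrightarrow> reduced_word w"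
  by (cases w) (auto simp: reduced_word_def)

lemma cons_red_eq_Cons: "reduced_word (l # w) \<Longrightarrow> cons_red l w = l # w"
  by (cases w) (auto simp: reduced_word_def)

lemma reduced_cons_red: "reduced_word w \<Longrightarrow> reduced_word (cons_red l w)"
  by (cases w) (auto simp: reduced_word_def dest: reduced_ConsD[unfolded reduced_word_def])

lemma cons_red_cancel: "reduced_word w \<Longrightarrow> cons_red l (cons_red (inv_letter l) w) = w"
proof (cases w)
  case (Cons m v)
  assume "reduced_word w"
  then show ?thesis using Cons by (auto simp: cons_red_eq_Cons)
qed simp

lemma reduced_foldr_cons_red: "reduced_word v \<Longrightarrow> reduced_word (foldr cons_red u v)"
  by (induction u) (auto simp: reduced_cons_red)

lemma foldr_cons_red_Nil: "reduced_word u \<Longrightarrow> foldr cons_red u [] = u"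
proof (induction u)
  case (Cons l u)
  then show ?case using reduced_ConsD[OF Cons.prems] by (simp add: cons_red_eq_Cons)
qed simp

lemma foldr_cons_red_cons_red:
  assumes "reduced_word v" "reduced_word x"
  shows "foldr cons_red (cons_red l v) x = cons_red l (foldr cons_red v x)"
proof (cases v)
  case (Cons m v')
  then show ?thesis
    using cons_red_cancel[OF reduced_foldr_cons_red[OF assms(2)]] by auto
qed simp

lemma foldr_cons_red_assoc:
  assumes "reduced_word v" "reduced_word x"
  shows "foldr cons_red (foldr cons_red u v) x = foldr cons_red u (foldr cons_red v x)"
  by (induction u) (simp_all add: foldr_cons_red_cons_red reduced_foldr_cons_red assms)

lemma foldr_cons_red_inverse:
  "reduced_word x \<Longrightarrow> foldr cons_red (rev (map inv_letter w)) (foldr cons_red w x) = x"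
proof (induction w)
  case (Cons l w)
  then show ?case
    using cons_red_cancel[of "foldr cons_red w x" "inv_letter l"]
    by (simp add: reduced_foldr_cons_red)
qed simp

lemma set_cons_red: "fst ` set (cons_red l w) \<subseteq> insert (fst l) (fst ` set w)"
  by (cases w) auto

lemma set_foldr_cons_red:
  "fst ` set (foldr cons_red u v) \<subseteq> fst ` set u \<union> fst ` set v"
proof (induction u)
  case (Cons l u)
  have "fst ` set (cons_red l (foldr cons_red u v)) \<subseteq>
      insert (fst l) (fst ` set (foldr cons_red u v))"
    by (rule set_cons_red)
  also have "\<dots> \<subseteq> insert (fst l) (fst ` set u \<union> fst ` set v)"
    using Cons.IH by (rule insert_mono)
  finally show ?case by simp
qed simp

lemma group_free_group: "group (free_group X)"
proof (rule groupI)
  fix u v assume "u \<in> carrier (free_group X)" "v \<in> carrier (free_group X)"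
  then show "u \<otimes>\<^bsub>free_group X\<^esub> v \<in> carrier (free_group X)"
    using order_trans[OF set_foldr_cons_red[of u v], of X]
    by (simp add: free_group_def reduced_foldr_cons_red)
next
  fix u assume u: "u \<in> carrier (free_group X)"
  let ?v = "foldr cons_red (rev (map inv_letter u)) []"
  have "fst ` set ?v \<subseteq> fst ` set u"
    using set_foldr_cons_red[of "rev (map inv_letter u)" "[]"] by (simp add: image_image)
  then have "?v \<in> carrier (free_group X)"
    using u by (auto simp: free_group_def reduced_foldr_cons_red)
  moreover have "foldr cons_red ?v u = []"
  proof -
    have "reduced_word u" using u by (simp add: free_group_def)
    then show ?thesis
      using foldr_cons_red_assoc[of "[]" u] foldr_cons_red_inverse[of "[]" u]
      by (simp add: foldr_cons_red_Nil)
  qed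
  ultimately show "\<exists>v \<in> carrier (free_group X). v \<otimes>\<^bsub>free_group X\<^esub> u = \<one>\<^bsub>free_group X\<^esub>"
    by (auto simp: free_group_def)
qed (auto simp: free_group_def foldr_cons_red_assoc)

lemma (in group) word_eval_closed:
  assumes "g \<in> X \<rightarrow> carrier G" "fst ` set w \<subseteq> X"
  shows "word_eval G g w \<in> carrier G"
  using assms(2) by (induction w) (use assms(1) in \<open>auto simp: word_eval_def Pi_iff\<close>)

lemma (in group) word_eval_cons_red:
  assumes "g \<in> X \<rightarrow> carrier G" "fst l \<in> X" "fst ` set w \<subseteq> X"
  shows "word_eval G g (cons_red l w) = word_eval G g [l] \<otimes> word_eval G g w"
proof (cases w)
  case Nil
  then show ?thesis using word_eval_closed[OF assms(1), of "[l]"] assms(2)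
    by (simp add: word_eval_def)
next
  case (Cons m v)
  have l: "g (fst l) \<in> carrier G" and v: "word_eval G g v \<in> carrier G"
    using assms Cons word_eval_closed[OF assms(1), of v] by auto
  show ?thesis
    using l v word_eval_closed[OF assms(1,3)] Cons
    by (cases l) (auto simp: word_eval_def inv_letter_def m_assoc[symmetric])
qed

lemma (in group) word_eval_hom:
  assumes "g \<in> X \<rightarrow> carrier G"
  shows "word_eval G g \<in> hom (free_group X) G"
proof (rule homI)
  fix u v assume "u \<in> carrier (free_group X)" "v \<in> carrier (free_group X)"
  then have u: "fst ` set u \<subseteq> X" and v: "fst ` set v \<subseteq> X"
    by (auto simp: free_group_def)
  from u have "word_eval G g (foldr cons_red u v) = word_eval G g u \<otimes> word_eval G g v"
  proof (induction u)
    case Nil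
    then show ?case using word_eval_closed[OF assms v] by (simp add: word_eval_def)
  next
    case (Cons l u)
    have "fst ` set u \<union> fst ` set v \<subseteq> X" using Cons.prems v by simp
    then have "fst ` set (foldr cons_red u v) \<subseteq> X"
      using set_foldr_cons_red[of u v] by (rule order_trans[rotated])
    then have "word_eval G g (foldr cons_red (l # u) v) =
        word_eval G g [l] \<otimes> (word_eval G g u \<otimes> word_eval G g v)"
      using Cons word_eval_cons_red[OF assms, of l "foldr cons_red u v"] by simp
    also have "\<dots> = word_eval G g [l] \<otimes> word_eval G g u \<otimes> word_eval G g v"
      using Cons.prems v by (intro m_assoc[symmetric] word_eval_closed[OF assms]) auto
    also have "word_eval G g [l] \<otimes> word_eval G g u = word_eval G g (l # u)"
      using Cons.prems word_eval_closed[OF assms, of u] assms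
      by (cases l) (auto simp: word_eval_def Pi_iff)
    finally show ?case .
  qed
  then show "word_eval G g (u \<otimes>\<^bsub>free_group X\<^esub> v) = word_eval G g u \<otimes> word_eval G g v"
    by (simp add: free_group_def)
qed (use assms in \<open>auto simp: free_group_def intro: word_eval_closed\<close>)

lemma (in group) word_eval_variable:
  "g i \<in> carrier G \<Longrightarrow> word_eval G g [(i, True)] = g i"
  by (simp add: word_eval_def)

end

theory Submission
  imports Defs "HOL-Algebra.Generated_Groups" "HOL-Algebra.Multiplicative_Group"
begin

text \<open>A continuous map on a compact space with fewer than continuum many values on an open set is
  constant on a smaller open set, so \<open>w\<close> is constant on some product of cosets of an open normal
  subgroup. Since \<open>w(\<dots>, a b, \<dots>) = w(\<dots>, a, \<dots>)\<^sup>* w(\<dots>, b, \<dots>)\<close>, where \<open>\<^sup>*\<close> conjugates the arguments by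
  elements of any normal subgroup containing \<open>b\<close>, an induction on the number of unrestricted arguments
  yields an open normal subgroup \<open>N\<close> such that \<open>w\<close> vanishes as soon as one argument lies in \<open>N\<close>.
  Hence \<open>w\<close> factors through the finite quotient \<open>G/N\<close>, and \<open>N\<close> centralises the subgroup \<open>H\<close> generated
  by the values. By Schur's theorem \<open>H'\<close> is finite, so the torsion elements \<open>R\<close> of \<open>H\<close> form a normal
  subgroup and \<open>G/R\<close> is soluble. Descending along the derived series of \<open>G/R\<close>, \<open>w\<close> is multiplicative
  in an argument taken from its deepest term; as \<open>g\<^bsup>|G/N|\<^esup> \<in> N\<close> for all \<open>g\<close>, the values are torsion
  modulo \<open>R\<close>, hence torsion. Finitely many torsion elements closed under conjugation generate a finite
  group.\<close>

section \<open>Compact spaces\<close>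

text \<open>Fewer than continuum many values suffice because a map that is nonconstant on every
  nonempty open subset separates the branches of a binary tree of closed sets, so it has a distinct
  value for each set of naturals. Each variable occurs once, so the product formula has only two
  factors; and conjugation by \<open>N\<close> maps each coset of \<open>N\<close> to itself, so
  boxes of cosets survive the conjugators. The obstacle comes afterwards: vanishing on
  \<open>N\<close> does not bound the orders of the values, since a power cannot simply be pulled
  out of an argument while conjugators disturb the others. In the deepest derived term they do no
  harm: they belong to the terms of all other arguments and change each of these only modulo the
  derived subgroup of its term, which is one step deeper and invisible to the word by induction.
  \<open>G\<close> itself need not be soluble; \<open>G/R\<close> is, because some term of the
  derived series of \<open>G\<close> lies in \<open>H\<close>, by induction on the word, while
  \<open>H'\<close> consists of torsion elements.\<close>

lemma continuous_constant_on_open: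
  assumes "compact_space X" "regular_space X" "continuous_map X Y f" "Hausdorff_space Y"
    and U: "openin X U" "U \<noteq> {}" and few: "\<not> (UNIV :: nat set set) \<lesssim> f ` U"
  shows "\<exists>V c. openin X V \<and> V \<noteq> {} \<and> V \<subseteq> U \<and> (\<forall>x\<in>V. f x = c)"
proof (rule ccontr)
  assume *: "\<not> ?thesis"
  have nonconst: "\<exists>x\<in>V. \<exists>y\<in>V. f x \<noteq> f y" if V: "openin X V" "V \<noteq> {}" "V \<subseteq> U" for V
  proof -
    obtain z where "z \<in> V" using V by blast
    then show ?thesis using * V by metis
  qed
  define good where "good V \<longleftrightarrow> openin X V \<and> V \<noteq> {} \<and> V \<subseteq> U" for V
  have shrink: "\<exists>W'. openin X W' \<and> x \<in> W' \<and> X closure_of W' \<subseteq> W" if "openin X W" "x \<in> W" for W x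
  proof -
    have "closedin X (topspace X - W)" "x \<in> topspace X - (topspace X - W)"
      using that openin_subset by auto
    then obtain W' where "openin X W'" "x \<in> W'" "disjnt (topspace X - W) (X closure_of W')"
      using assms(2) unfolding regular_space by meson
    then show ?thesis using closure_of_subset_topspace[of X W'] by (auto simp: disjnt_iff)
  qed
  \<comment> \<open>Disjoint open sets separate two distinct values, and regularity shrinks their
    preimages until even the closures have disjoint images. Closures matter because compactness will
    produce the branch points.\<close>
  have "\<exists>s. \<forall>b. good (s b) \<and> X closure_of (s b) \<subseteq> V \<and>
      f ` (X closure_of s True) \<inter> f ` (X closure_of s False) = {}" if "good V" for V
  proof -
    obtain x y where xy: "x \<in> V" "y \<in> V" "f x \<noteq> f y"
      using nonconst \<open>good V\<close> unfolding good_def by blast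
    have V: "openin X V" "V \<subseteq> U" using that by (auto simp: good_def)
    then have "x \<in> topspace X" "y \<in> topspace X" using xy openin_subset by blast+
    then have "f x \<in> topspace Y" "f y \<in> topspace Y"
      using assms(3) by (auto simp: continuous_map_def)
    then obtain A B where AB: "openin Y A" "openin Y B" "f x \<in> A" "f y \<in> B" "disjnt A B"
      using assms(4) xy(3) unfolding Hausdorff_space_def by meson
    let ?A = "V \<inter> {x \<in> topspace X. f x \<in> A}" and ?B = "V \<inter> {x \<in> topspace X. f x \<in> B}"
    have "openin X ?A" "openin X ?B"
      using AB V assms(3) openin_continuous_map_preimage by blast+
    moreover have "x \<in> ?A" "y \<in> ?B"
      using xy AB \<open>x \<in> topspace X\<close> \<open>y \<in> topspace X\<close> by auto
    ultimately obtain A' B' where A': "openin X A'" "x \<in> A'" "X closure_of A' \<subseteq> ?A"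
      and B': "openin X B'" "y \<in> B'" "X closure_of B' \<subseteq> ?B"
      using shrink by meson
    have "A' \<subseteq> X closure_of A'" "B' \<subseteq> X closure_of B'"
      using A' B' by (simp_all add: closure_of_subset openin_subset)
    then have "good A'" "good B'" using A' B' V by (auto simp: good_def)
    moreover have "f ` (X closure_of A') \<inter> f ` (X closure_of B') = {}"
      using A' B' AB(5) by (fastforce simp: disjnt_iff)
    ultimately show ?thesis
      using A' B' by (intro exI[of _ "\<lambda>b. if b then A' else B'"]) auto
  qed
  then obtain s where s: "\<And>V b. good V \<Longrightarrow> good (s V b)"
      "\<And>V b. good V \<Longrightarrow> X closure_of (s V b) \<subseteq> V"
      "\<And>V. good V \<Longrightarrow> f ` (X closure_of s V True) \<inter> f ` (X closure_of s V False) = {}"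
    by metis
  \<comment> \<open>A Cantor scheme: \<open>W A n\<close> follows the first \<open>n\<close> binary
    digits of \<open>A\<close>. At the first digit where \<open>A\<close> and \<open>B\<close>
    differ, a common set splits into children with disjoint images.\<close>
  define W where "W A = rec_nat U (\<lambda>n V. s V (n \<in> A))" for A :: "nat set"
  have W0: "W A 0 = U" and WS: "W A (Suc n) = s (W A n) (n \<in> A)" for A n
    by (simp_all add: W_def)
  have good: "good (W A n)" for A n
    by (induction n) (use U s(1) in \<open>auto simp: W0 WS good_def\<close>)
  have sub: "W A n \<subseteq> X closure_of W A n" for A n
    using good[of A n] by (simp add: good_def closure_of_subset openin_subset)
  have "(\<Inter>n. X closure_of W A n) \<noteq> {}" for A
  proof (rule compact_space_imp_nest[OF assms(1)])
    show "X closure_of W A n \<noteq> {}" for n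
      using sub[of A n] good[of A n] by (auto simp: good_def)
    show "decseq (\<lambda>n. X closure_of W A n)"
      unfolding decseq_Suc_iff using s(2)[OF good] subset_trans[OF _ sub] by (simp add: WS)
  qed simp
  then have "\<forall>A. \<exists>x. \<forall>n. x \<in> X closure_of W A n" by blast
  from choice[OF this] obtain p where p: "\<And>A n. p A \<in> X closure_of W A n" by blast
  \<comment> \<open>Stage 1 instead of stage 0: the closure of \<open>W A 0 = U\<close> may leave
    \<open>U\<close>, that of its child does not.\<close>
  have "p A \<in> U" for A
    using p[of A "Suc 0"] s(2)[OF good[of A 0]] by (auto simp: W0 WS)
  moreover have "f (p A) \<noteq> f (p B)" if "A \<noteq> B" for A B
  proof -
    define n where "n = (LEAST n. (n \<in> A) \<noteq> (n \<in> B))"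
    have "\<exists>n. (n \<in> A) \<noteq> (n \<in> B)" using that by blast
    then have n: "(n \<in> A) \<noteq> (n \<in> B)" unfolding n_def by (rule LeastI_ex)
    have less: "(m \<in> A) = (m \<in> B)" if "m < n" for m
      using that not_less_Least unfolding n_def by blast
    have "m \<le> n \<Longrightarrow> W A m = W B m" for m
      by (induction m) (use less in \<open>auto simp: W0 WS\<close>)
    then have "W A n = W B n" by simp
    then show ?thesis
      using s(3)[OF good[of A n]] p[of A "Suc n"] p[of B "Suc n"] n
      by (cases "n \<in> A") (auto simp: WS)
  qed
  ultimately have "inj (\<lambda>A. f (p A))" "range (\<lambda>A. f (p A)) \<subseteq> f ` U"
    by (auto intro!: injI)
  with few show False unfolding lepoll_def by blast
qed

section \<open>Clopen neighbourhoods in compact totally disconnected spaces\<close>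

lemma clopen_between_quasi_component:
  assumes "x \<in> topspace X" "compactin X K" "disjnt (quasi_component_of_set X x) K"
  obtains C where "openin X C" "closedin X C" "x \<in> C" "disjnt C K"
proof -
  have "quasi_component_of_set X x \<in> quasi_components_of X"
    using assms(1) by (simp add: quasi_component_in_quasi_components_of)
  then have "separated_between X (quasi_component_of_set X x) K"
    using assms separated_between_quasi_component_compact by blast
  moreover have "x \<in> quasi_component_of_set X x" using assms(1) by simp
  ultimately obtain U V where UV: "openin X U" "openin X V" "U \<union> V = topspace X" "disjnt U V"
      "x \<in> U" "K \<subseteq> V"
    unfolding separated_between_def by blast
  then have "U = topspace X - V" by (auto simp: disjnt_iff)
  then have "closedin X U" using UV by blast
  moreover have "disjnt U K" using UV by (auto simp: disjnt_iff)
  ultimately show thesis using that UV by blast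
qed

text \<open>A splitting into disjoint closed pieces extends to disjoint open sets \<open>U\<close>,
  \<open>V\<close> by normality. By compactness some clopen \<open>C\<close> around \<open>x\<close>
  fits into \<open>U \<union> V\<close>; if \<open>x\<close> is in \<open>U\<close>, then
  \<open>C \<inter> U\<close> is clopen and contains the whole quasi-component, so the piece in
  \<open>V\<close> is empty.\<close>

lemma connectedin_quasi_component_of:
  assumes "compact_space X" "Hausdorff_space X"
  shows "connectedin X (quasi_component_of_set X x)"
proof (cases "x \<in> topspace X")
  case True
  let ?Q = "quasi_component_of_set X x"
  have *: False if AB: "closedin X A" "closedin X B" "?Q \<subseteq> A \<union> B" "A \<inter> B = {}"
      "B \<inter> ?Q \<noteq> {}" "x \<in> A" for A B
  proof -
    have "normal_space X" using assms by (simp add: compact_Hausdorff_or_regular_imp_normal_space)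
    then obtain U V where UV: "openin X U" "openin X V" "A \<subseteq> U" "B \<subseteq> V" "disjnt U V"
      using AB unfolding normal_space_def disjnt_def by meson
    have "compactin X (topspace X - (U \<union> V))"
      using UV assms(1) by (intro closedin_compact_space) auto
    moreover have "disjnt ?Q (topspace X - (U \<union> V))" using AB(3) UV by (auto simp: disjnt_iff)
    ultimately obtain C where C: "openin X C" "closedin X C" "x \<in> C" "disjnt C (topspace X - (U \<union> V))"
      using True clopen_between_quasi_component by metis
    then have CUV: "C \<subseteq> U \<union> V" using openin_subset by (fastforce simp: disjnt_iff)
    have "openin X (C \<inter> U)" using C UV by blast
    moreover have "C \<inter> U = C - V" using CUV UV(5) by (auto simp: disjnt_iff)
    then have "closedin X (C \<inter> U)" using C UV by (simp add: closedin_diff)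
    moreover have "x \<in> C \<inter> U" using C UV AB by blast
    ultimately have "?Q \<subseteq> C \<inter> U" unfolding quasi_component_of by blast
    then show False using AB(5) UV by (auto simp: disjnt_iff)
  qed
  have "x \<in> ?Q" using True by simp
  have sub: "?Q \<subseteq> topspace X" by (rule quasi_component_of_subset_topspace)
  show ?thesis
    unfolding connectedin_closedin
  proof (intro conjI sub notI)
    assume "\<exists>E1 E2. closedin X E1 \<and> closedin X E2 \<and> ?Q \<subseteq> E1 \<union> E2 \<and> E1 \<inter> E2 \<inter> ?Q = {} \<and>
      E1 \<inter> ?Q \<noteq> {} \<and> E2 \<inter> ?Q \<noteq> {}"
    then obtain E1 E2 where E: "closedin X E1" "closedin X E2" "?Q \<subseteq> E1 \<union> E2"
      "E1 \<inter> E2 \<inter> ?Q = {}" "E1 \<inter> ?Q \<noteq> {}" "E2 \<inter> ?Q \<noteq> {}" by blast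
    have cl: "closedin X (E1 \<inter> ?Q)" "closedin X (E2 \<inter> ?Q)"
      using E by (auto simp: closedin_quasi_component_of)
    show False
    proof (cases "x \<in> E1")
      case True
      then show False using *[OF cl] E \<open>x \<in> ?Q\<close> by blast
    next
      case False
      then show False using *[OF cl(2,1)] E \<open>x \<in> ?Q\<close> by blast
    qed
  qed
next
  case False
  then have "quasi_component_of_set X x = {}" by (simp only: quasi_component_of_eq_empty not_False_eq_True)
  then show ?thesis by (simp only: connectedin_empty)
qed

text \<open>Total disconnectedness speaks of connected sets. It yields clopen sets because
  quasi-components are connected here, hence singletons, and clopen sets separate them from compact
  sets.\<close>

lemma clopen_neighbourhood:
  assumes "compact_space X" "Hausdorff_space X" "totally_disconnected_space X"
    and U: "openin X U" "x \<in> U"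
  obtains C where "openin X C" "closedin X C" "x \<in> C" "C \<subseteq> U"
proof -
  have x: "x \<in> topspace X" using U openin_subset by blast
  have "quasi_component_of_set X x \<subseteq> {x}"
    using connectedin_quasi_component_of[OF assms(1,2), of x] assms(3) x
    unfolding totally_disconnected_space_def
    by (metis mem_Collect_eq quasi_component_of_refl singletonD subsetD)
  then have "disjnt (quasi_component_of_set X x) (topspace X - U)"
    using U by (auto simp: disjnt_iff)
  moreover have "compactin X (topspace X - U)"
    using U assms(1) by (intro closedin_compact_space) auto
  ultimately obtain C where C: "openin X C" "closedin X C" "x \<in> C" "disjnt C (topspace X - U)"
    using x clopen_between_quasi_component by metis
  moreover have "C \<subseteq> U" using C openin_subset by (fastforce simp: disjnt_iff)
  ultimately show thesis using that by blast
qed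

section \<open>Outer commutator words as trees\<close>

text \<open>Reduced words do not display their bracketing; trees do, so that the later inductions
  can follow the nesting of commutators.\<close>

datatype outer_commutator = Var nat | Comm outer_commutator outer_commutator

primrec vars :: "outer_commutator \<Rightarrow> nat set" where
  "vars (Var i) = {i}"
| "vars (Comm s t) = vars s \<union> vars t"

primrec multilinear :: "outer_commutator \<Rightarrow> bool" where
  "multilinear (Var i) \<longleftrightarrow> True"
| "multilinear (Comm s t) \<longleftrightarrow> multilinear s \<and> multilinear t \<and> vars s \<inter> vars t = {}"

primrec ceval :: "('a, 'm) monoid_scheme \<Rightarrow> outer_commutator \<Rightarrow> (nat \<Rightarrow> 'a) \<Rightarrow> 'a" where
  "ceval G (Var i) x = x i"
| "ceval G (Comm s t) x = commutator G (ceval G s x) (ceval G t x)"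

lemma finite_vars [simp]: "finite (vars t)"
  by (induction t) auto

lemma vars_nonempty [simp]: "vars t \<noteq> {}"
  by (induction t) auto

lemma ceval_cong: "(\<And>i. i \<in> vars t \<Longrightarrow> x i = y i) \<Longrightarrow> ceval G t x = ceval G t y"
  by (induction t) auto

lemma inv_free_group:
  assumes "reduced_word u"
  shows "reduced_word (rev (map inv_letter u))"
    and "inv\<^bsub>free_group UNIV\<^esub> u = rev (map inv_letter u)"
proof -
  show *: "reduced_word (rev (map inv_letter u))"
    using assms unfolding reduced_word_def successively_rev successively_map
    by (rule successively_mono) (metis inv_letter_inv_letter)
  show "inv\<^bsub>free_group UNIV\<^esub> u = rev (map inv_letter u)"
  proof (rule group.inv_equality[OF group_free_group])
    show "rev (map inv_letter u) \<otimes>\<^bsub>free_group UNIV\<^esub> u = \<one>\<^bsub>free_group UNIV\<^esub>"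
      using foldr_cons_red_inverse[of "[]" u] foldr_cons_red_Nil[OF assms]
      by (simp add: free_group_def)
  qed (use assms * in \<open>auto simp: free_group_def\<close>)
qed

lemma reduced_word_append:
  assumes "reduced_word u" "reduced_word v" "u \<noteq> [] \<Longrightarrow> v \<noteq> [] \<Longrightarrow> fst (last u) \<noteq> fst (hd v)"
  shows "reduced_word (u @ v)"
  using assms unfolding reduced_word_def successively_append_iff by (metis fst_inv_letter)

text \<open>Every junction in \<open>u\<inverse> v\<inverse> u v\<close> joins a letter of one word
  to a letter of the other; their variables differ, so nothing cancels. Hence no variable is lost,
  and the reduced word has exactly the variables of the tree.\<close>

lemma commutator_free_group:
  assumes "reduced_word u" "reduced_word v" "u \<noteq> []" "v \<noteq> []" "fst ` set u \<inter> fst ` set v = {}"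
  shows "commutator (free_group UNIV) u v = rev (map inv_letter u) @ rev (map inv_letter v) @ u @ v"
    and "reduced_word (rev (map inv_letter u) @ rev (map inv_letter v) @ u @ v)"
proof -
  let ?u = "rev (map inv_letter u)" and ?v = "rev (map inv_letter v)"
  have neq: "fst l \<noteq> fst m" if "l \<in> set u" "m \<in> set v" for l m
    using that assms(5) by (metis disjoint_iff imageI)
  have hd_last: "hd u \<in> set u" "last u \<in> set u" "hd v \<in> set v" "last v \<in> set v"
    using assms by auto
  have r3: "reduced_word (u @ v)"
    using assms hd_last neq by (intro reduced_word_append) auto
  have "reduced_word (?v @ u @ v)"
    using assms hd_last neq[of "hd u" "hd v"] neq[of "last u" "hd v"] inv_free_group
    by (intro reduced_word_append) (auto simp: last_rev hd_map hd_append)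
  then show r: "reduced_word (?u @ ?v @ u @ v)"
    using assms hd_last neq[of "hd u" "hd v"] neq[of "last u" "hd v"] neq[of "hd u" "last v"]
      inv_free_group
    by (intro reduced_word_append) (auto simp: last_rev hd_map hd_rev last_map hd_append)
  have "commutator (free_group UNIV) u v = foldr cons_red (foldr cons_red (foldr cons_red ?u ?v) u) v"
    using inv_free_group assms by (simp add: commutator_def free_group_def)
  also have "\<dots> = foldr cons_red ?u (foldr cons_red ?v (foldr cons_red u v))"
    using assms inv_free_group by (simp add: foldr_cons_red_assoc reduced_foldr_cons_red)
  also have "\<dots> = foldr cons_red (?u @ ?v @ u @ v) []"
    using assms by (simp add: foldr_cons_red_Nil)
  also have "\<dots> = ?u @ ?v @ u @ v" using r by (rule foldr_cons_red_Nil)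
  finally show "commutator (free_group UNIV) u v = ?u @ ?v @ u @ v" .
qed

lemma multilinear_commutator_word_reduced:
  assumes "multilinear_commutator_word w"
  shows "reduced_word w \<and> w \<noteq> []"
  using assms
proof induction
  case (variable i)
  then show ?case by (simp add: reduced_word_def)
next
  case (commutator u v)
  then show ?case using commutator_free_group[of u v] by simp
qed

section \<open>Conjugation, commutators and the product formula\<close>

context group
begin

lemma inv_cancel_left [simp]:
  "x \<in> carrier G \<Longrightarrow> y \<in> carrier G \<Longrightarrow> inv x \<otimes> (x \<otimes> y) = y"
  "x \<in> carrier G \<Longrightarrow> y \<in> carrier G \<Longrightarrow> x \<otimes> (inv x \<otimes> y) = y"
  by (simp_all add: m_assoc[symmetric])

lemmas group_normalize = m_assoc inv_mult_group

definition conjugate :: "'a \<Rightarrow> 'a \<Rightarrow> 'a" where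
  "conjugate h a = inv h \<otimes> a \<otimes> h"

lemma conjugate_closed [simp]: "h \<in> carrier G \<Longrightarrow> a \<in> carrier G \<Longrightarrow> conjugate h a \<in> carrier G"
  by (simp add: conjugate_def)

lemma conjugate_one [simp]: "a \<in> carrier G \<Longrightarrow> conjugate \<one> a = a"
  by (simp add: conjugate_def)

lemma conjugate_conjugate:
  "g \<in> carrier G \<Longrightarrow> h \<in> carrier G \<Longrightarrow> a \<in> carrier G \<Longrightarrow> conjugate h (conjugate g a) = conjugate (g \<otimes> h) a"
  by (simp add: conjugate_def group_normalize)

lemma conjugate_mult:
  "h \<in> carrier G \<Longrightarrow> a \<in> carrier G \<Longrightarrow> b \<in> carrier G \<Longrightarrow> conjugate h (a \<otimes> b) = conjugate h a \<otimes> conjugate h b"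
  by (simp add: conjugate_def group_normalize)

lemma normal_conjugate_closed:
  assumes "N \<lhd> G" "h \<in> carrier G" "a \<in> N"
  shows "conjugate h a \<in> N"
  using normal.inv_op_closed1[OF assms(1,2,3)] by (simp add: conjugate_def)

lemma commutator_closed [simp]:
  "a \<in> carrier G \<Longrightarrow> b \<in> carrier G \<Longrightarrow> commutator G a b \<in> carrier G"
  by (simp add: commutator_def)

lemma conjugate_commutator:
  "h \<in> carrier G \<Longrightarrow> a \<in> carrier G \<Longrightarrow> b \<in> carrier G \<Longrightarrow>
    conjugate h (commutator G a b) = commutator G (conjugate h a) (conjugate h b)"
  by (simp add: conjugate_def commutator_def group_normalize)

lemma commutator_in_normal:
  assumes "N \<lhd> G" "a \<in> carrier G" "b \<in> carrier G" "a \<in> N \<or> b \<in> N"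
  shows "commutator G a b \<in> N"
proof -
  interpret N: normal N G by fact
  have "commutator G a b = inv a \<otimes> conjugate b a" "commutator G a b = conjugate a (inv b) \<otimes> b"
    using assms by (simp_all add: commutator_def conjugate_def group_normalize)
  then show ?thesis using assms normal_conjugate_closed[OF assms(1)] N.m_closed N.m_inv_closed by metis
qed

lemma commutator_mult_left:
  assumes "a \<in> carrier G" "b \<in> carrier G" "c \<in> carrier G"
  shows "commutator G (a \<otimes> b) c = commutator G (conjugate b a) (conjugate b c) \<otimes> commutator G b c"
  using assms by (simp add: commutator_def conjugate_def group_normalize)

text \<open>The usual \<open>[c, a b] = [c, b] [c, a]^b\<close> with its factors exchanged, so that
  the one containing \<open>a\<close> comes first. This turns the conjugator \<open>b\<close> into
  \<open>b [c, b]\<inverse> = c\<inverse> b c\<close>, which lies in every normal subgroup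
  containing \<open>b\<close>.\<close>

lemma commutator_mult_right:
  assumes "a \<in> carrier G" "b \<in> carrier G" "c \<in> carrier G"
  shows "commutator G c (a \<otimes> b) =
    commutator G (conjugate (conjugate c b) c) (conjugate (conjugate c b) a) \<otimes> commutator G c b"
  using assms by (simp add: commutator_def conjugate_def group_normalize)

lemma word_eval_cong:
  "(\<And>i. i \<in> fst ` set w \<Longrightarrow> g i = g' i) \<Longrightarrow> word_eval G g w = word_eval G g' w"
  by (induction w) (auto simp: word_eval_def)

lemma ceval_closed [simp]: "x \<in> UNIV \<rightarrow> carrier G \<Longrightarrow> ceval G t x \<in> carrier G"
  by (induction t) auto

text \<open>Evaluation is a homomorphism on the free group, so each group commutator becomes a
  \<open>Comm\<close> node; the absence of cancellation keeps track of the variables and hence of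
  multilinearity.\<close>

lemma multilinear_commutator_word_ceval:
  assumes "multilinear_commutator_word w"
  shows "\<exists>t. multilinear t \<and> vars t = fst ` set w \<and>
    (\<forall>g \<in> UNIV \<rightarrow> carrier G. word_eval G g w = ceval G t g)"
  using assms
proof induction
  case (variable i)
  show ?case by (rule exI[of _ "Var i"]) (auto simp: word_eval_variable Pi_iff)
next
  case (commutator u v)
  then obtain s t where s: "multilinear s" "vars s = fst ` set u"
      "\<And>g. g \<in> UNIV \<rightarrow> carrier G \<Longrightarrow> word_eval G g u = ceval G s g"
    and t: "multilinear t" "vars t = fst ` set v"
      "\<And>g. g \<in> UNIV \<rightarrow> carrier G \<Longrightarrow> word_eval G g v = ceval G t g" by metis
  have uv: "reduced_word u" "u \<noteq> []" "reduced_word v" "v \<noteq> []"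
    using commutator multilinear_commutator_word_reduced by auto
  have F: "u \<in> carrier (free_group UNIV)" "v \<in> carrier (free_group UNIV)"
    using uv by (auto simp: free_group_def)
  have "word_eval G g (commutator (free_group UNIV) u v) = ceval G (Comm s t) g"
    if g: "g \<in> UNIV \<rightarrow> carrier G" for g
  proof -
    interpret F: group "free_group UNIV" by (rule group_free_group)
    interpret E: group_hom "free_group UNIV" G "word_eval G g"
      by unfold_locales (rule word_eval_hom[OF g])
    show ?thesis using F s(3)[OF g] t(3)[OF g] by (simp add: commutator_def)
  qed
  moreover have "fst ` set (commutator (free_group UNIV) u v) = vars (Comm s t)"
    using commutator_free_group(1)[OF uv(1,3,2,4)] commutator.hyps s t
    by (auto simp: image_Un image_image)
  ultimately show ?case
    using s t commutator.hyps by (intro exI[of _ "Comm s t"]) auto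
qed

lemma ceval_conjugate:
  "x \<in> UNIV \<rightarrow> carrier G \<Longrightarrow> h \<in> carrier G \<Longrightarrow>
    ceval G t (\<lambda>i. conjugate h (x i)) = conjugate h (ceval G t x)"
  by (induction t) (auto simp: conjugate_commutator)

lemma ceval_in_normal:
  assumes "N \<lhd> G" "x \<in> UNIV \<rightarrow> carrier G" "i \<in> vars t" "x i \<in> N"
  shows "ceval G t x \<in> N"
  using assms by (induction t) (auto intro!: commutator_in_normal)

lemma ceval_eq_one:
  assumes "x \<in> UNIV \<rightarrow> carrier G" "i \<in> vars t" "x i = \<one>"
  shows "ceval G t x = \<one>"
  using ceval_in_normal[OF one_is_normal assms(1,2)] assms(3) by simp

text \<open>By multilinearity only one side of a commutator contains \<open>x i\<close>, and the
  other side does not change. The commutator identities then add one more conjugation, by an element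
  of \<open>N\<close>, to all arguments. \<open>N\<close> is left arbitrary because it will be
  \<open>G\<close>, an open normal subgroup, or a term of the derived series.\<close>

lemma ceval_mult:
  assumes "multilinear t" "i \<in> vars t" and N: "N \<lhd> G"
    and ab: "a \<in> carrier G" "b \<in> N" and x: "x \<in> UNIV \<rightarrow> carrier G"
  shows "\<exists>h \<in> UNIV \<rightarrow> N. ceval G t (x(i := a \<otimes> b)) =
    ceval G t (\<lambda>j. conjugate (h j) ((x(i := a)) j)) \<otimes> ceval G t (x(i := b))"
  using assms(1,2)
proof (induction t)
  case (Var k)
  interpret N: normal N G by fact
  show ?case using Var ab by (intro bexI[of _ "\<lambda>_. \<one>"]) auto
next
  case (Comm s t)
  interpret N: normal N G by fact
  have b: "b \<in> carrier G" using ab by simp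
  have xa: "x(i := a) \<in> UNIV \<rightarrow> carrier G" and xb: "x(i := b) \<in> UNIV \<rightarrow> carrier G"
    using x ab b by auto
  show ?case
  proof (cases "i \<in> vars s")
    case True
    then have i: "i \<notin> vars t" using Comm.prems by auto
    obtain h where h: "h \<in> UNIV \<rightarrow> N" "ceval G s (x(i := a \<otimes> b)) =
        ceval G s (\<lambda>j. conjugate (h j) ((x(i := a)) j)) \<otimes> ceval G s (x(i := b))"
      using Comm.IH(1) Comm.prems True by (metis multilinear.simps(2))
    define p where "p = ceval G s (x(i := b))"
    have p: "p \<in> N" unfolding p_def using True ab by (intro ceval_in_normal[OF N xb]) auto
    have hG: "h j \<in> carrier G" for j using h(1) N.subset by blast
    have xh: "(\<lambda>j. conjugate (h j) ((x(i := a)) j)) \<in> UNIV \<rightarrow> carrier G"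
      using hG xa by (auto intro!: conjugate_closed)
    \<comment> \<open>The arguments of \<open>s\<close> are conjugated by the inductive
      \<open>h j\<close> and then by \<open>p\<close>, all others by \<open>p\<close> alone.\<close>
    define h' where "h' j = (if j \<in> vars s then h j \<otimes> p else p)" for j
    have t_eq: "ceval G t (x(i := y)) = ceval G t x" for y
      using i by (intro ceval_cong) auto
    have "ceval G s (\<lambda>j. conjugate (h' j) ((x(i := a)) j)) =
        ceval G s (\<lambda>j. conjugate p (conjugate (h j) ((x(i := a)) j)))"
      using hG p xa by (intro ceval_cong) (simp add: h'_def conjugate_conjugate Pi_iff)
    also have "\<dots> = conjugate p (ceval G s (\<lambda>j. conjugate (h j) ((x(i := a)) j)))"
      using p by (intro ceval_conjugate[OF xh]) auto
    finally have s': "ceval G s (\<lambda>j. conjugate (h' j) ((x(i := a)) j)) = \<dots>" .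
    have "ceval G t (\<lambda>j. conjugate (h' j) ((x(i := a)) j)) = ceval G t (\<lambda>j. conjugate p (x j))"
      using i Comm.prems by (intro ceval_cong) (auto simp: h'_def)
    also have "\<dots> = conjugate p (ceval G t x)" using p by (intro ceval_conjugate[OF x]) auto
    finally have t': "ceval G t (\<lambda>j. conjugate (h' j) ((x(i := a)) j)) = \<dots>" .
    have "h' \<in> UNIV \<rightarrow> N" using h(1) p by (auto simp: h'_def Pi_iff)
    moreover have "ceval G (Comm s t) (x(i := a \<otimes> b)) =
      ceval G (Comm s t) (\<lambda>j. conjugate (h' j) ((x(i := a)) j)) \<otimes> ceval G (Comm s t) (x(i := b))"
      unfolding ceval.simps h(2) s' t' t_eq p_def[symmetric]
      using p xh x by (intro commutator_mult_left) auto
    ultimately show ?thesis by blast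
  next
    case False
    then have i: "i \<in> vars t" using Comm.prems by auto
    obtain h where h: "h \<in> UNIV \<rightarrow> N" "ceval G t (x(i := a \<otimes> b)) =
        ceval G t (\<lambda>j. conjugate (h j) ((x(i := a)) j)) \<otimes> ceval G t (x(i := b))"
      using Comm.IH(2) Comm.prems i by (metis multilinear.simps(2))
    define q where "q = ceval G t (x(i := b))"
    \<comment> \<open>The conjugator that \<open>commutator_mult_right\<close> produces.\<close>
    define p where "p = conjugate (ceval G s x) q"
    have q: "q \<in> N" unfolding q_def using i ab by (intro ceval_in_normal[OF N xb]) auto
    then have p: "p \<in> N" unfolding p_def using x by (intro normal_conjugate_closed[OF N]) auto
    have hG: "h j \<in> carrier G" for j using h(1) N.subset by blast
    have xh: "(\<lambda>j. conjugate (h j) ((x(i := a)) j)) \<in> UNIV \<rightarrow> carrier G"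
      using hG xa by (auto intro!: conjugate_closed)
    define h' where "h' j = (if j \<in> vars t then h j \<otimes> p else p)" for j
    have s_eq: "ceval G s (x(i := y)) = ceval G s x" for y
      using False by (intro ceval_cong) auto
    have "ceval G t (\<lambda>j. conjugate (h' j) ((x(i := a)) j)) =
        ceval G t (\<lambda>j. conjugate p (conjugate (h j) ((x(i := a)) j)))"
      using hG p xa by (intro ceval_cong) (simp add: h'_def conjugate_conjugate Pi_iff)
    also have "\<dots> = conjugate p (ceval G t (\<lambda>j. conjugate (h j) ((x(i := a)) j)))"
      using p by (intro ceval_conjugate[OF xh]) auto
    finally have t': "ceval G t (\<lambda>j. conjugate (h' j) ((x(i := a)) j)) = \<dots>" .
    have "ceval G s (\<lambda>j. conjugate (h' j) ((x(i := a)) j)) = ceval G s (\<lambda>j. conjugate p (x j))"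
      using False Comm.prems by (intro ceval_cong) (auto simp: h'_def)
    also have "\<dots> = conjugate p (ceval G s x)" using p by (intro ceval_conjugate[OF x]) auto
    finally have s': "ceval G s (\<lambda>j. conjugate (h' j) ((x(i := a)) j)) = \<dots>" .
    have "h' \<in> UNIV \<rightarrow> N" using h(1) p by (auto simp: h'_def Pi_iff)
    moreover have "ceval G (Comm s t) (x(i := a \<otimes> b)) =
      ceval G (Comm s t) (\<lambda>j. conjugate (h' j) ((x(i := a)) j)) \<otimes> ceval G (Comm s t) (x(i := b))"
      unfolding ceval.simps h(2) s' t' s_eq q_def[symmetric] p_def
      using q xh x by (intro commutator_mult_right) auto
    ultimately show ?thesis by blast
  qed
qed

end

section \<open>Words constant on cosets\<close>

text \<open>One coordinate is replaced at a time, from \<open>x i\<close> straight to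
  \<open>y i\<close>. The sets \<open>A j\<close> carry the constraints under which a single
  replacement is harmless and which all intermediate points obey.\<close>

lemma finite_coordinate_change:
  fixes f :: "(nat \<Rightarrow> 'a) \<Rightarrow> 'b"
  assumes "finite I"
    and step: "\<And>x i b. (\<And>j. x j \<in> A j) \<Longrightarrow> i \<in> I \<Longrightarrow> b \<in> A i \<Longrightarrow> r i (x i) b \<Longrightarrow> f (x(i := b)) = f x"
    and "\<And>j. x j \<in> A j" "\<And>j. y j \<in> A j"
    and "\<And>i. i \<in> I \<Longrightarrow> r i (x i) (y i)" "\<And>i. i \<notin> I \<Longrightarrow> x i = y i"
  shows "f y = f x"
  using assms
proof (induction I arbitrary: y rule: finite_induct)
  case empty
  then have "x = y" by auto
  then show ?case by simp
next
  case (insert i I)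
  let ?z = "y(i := x i)"
  have "f ?z = f x"
  proof (rule insert.IH)
    show "\<And>x i b. (\<And>j. x j \<in> A j) \<Longrightarrow> i \<in> I \<Longrightarrow> b \<in> A i \<Longrightarrow> r i (x i) b \<Longrightarrow> f (x(i := b)) = f x"
      using insert.prems(1) by blast
    show "r j (x j) (?z j)" if "j \<in> I" for j
      using that insert.prems(4)[of j] insert.hyps by auto
    show "x j = ?z j" if "j \<notin> I" for j
      using that insert.prems(5)[of j] by auto
    show "?z j \<in> A j" for j using insert.prems(2,3) by auto
  qed (use insert.prems in auto)
  moreover have "f (?z(i := y i)) = f ?z"
  proof (rule insert.prems(1))
    show "?z j \<in> A j" for j using insert.prems(2,3) by auto
  qed (use insert.prems in auto)
  ultimately show ?case by simp
qed

context group
begin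

lemma mem_l_coset_iff:
  assumes "subgroup N G" "a \<in> carrier G" "b \<in> carrier G"
  shows "b \<in> a <# N \<longleftrightarrow> inv a \<otimes> b \<in> N"
proof
  assume "b \<in> a <# N"
  then obtain n where n: "n \<in> N" "b = a \<otimes> n" by (auto simp: l_coset_def)
  moreover have "n \<in> carrier G" using n subgroup.mem_carrier[OF assms(1)] by blast
  ultimately show "inv a \<otimes> b \<in> N" using assms by simp
next
  assume *: "inv a \<otimes> b \<in> N"
  have "b = a \<otimes> (inv a \<otimes> b)" using assms by simp
  then show "b \<in> a <# N" using * by (auto simp: l_coset_def)
qed

lemma conjugate_mem_l_coset:
  assumes "N \<lhd> G" "a \<in> carrier G" "b \<in> a <# N" "h \<in> N"
  shows "conjugate h b \<in> a <# N"
proof -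
  interpret N: normal N G by fact
  obtain n where n: "n \<in> N" "b = a \<otimes> n" using assms by (auto simp: l_coset_def)
  have "conjugate h b = a \<otimes> (conjugate a (inv h) \<otimes> (n \<otimes> h))"
    using n assms by (simp add: conjugate_def group_normalize)
  moreover have "conjugate a (inv h) \<otimes> (n \<otimes> h) \<in> N"
    using n assms normal_conjugate_closed[OF assms(1)] by simp
  ultimately show ?thesis by (auto simp: l_coset_def)
qed

text \<open>Boxes between a product of cosets (\<open>I = {}\<close>) and \<open>N\<close> in all
  variables (\<open>I = vars t\<close>). Left cosets suit \<open>ceval_mult\<close>, where the
  factor from \<open>N\<close> stands on the right.\<close>

definition coset_class ::
    "outer_commutator \<Rightarrow> 'a set \<Rightarrow> (nat \<Rightarrow> 'a) \<Rightarrow> nat set \<Rightarrow> (nat \<Rightarrow> 'a) set" where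
  "coset_class t N y I = {x \<in> UNIV \<rightarrow> carrier G.
    (\<forall>i \<in> vars t \<inter> I. x i \<in> N) \<and> (\<forall>i \<in> vars t - I. x i \<in> y i <# N)}"

text \<open>Both \<open>y j\<close> and \<open>y j \<otimes> x j\<close> are admissible as argument
  \<open>j\<close> in the box for \<open>I\<close>. In \<open>ceval_mult\<close> the conjugators lie
  in \<open>N\<close> and keep the first factor in that box, so the formula reads
  \<open>c = c \<otimes> ceval G t x\<close>.\<close>

lemma ceval_constant_insert:
  assumes t: "multilinear t" and N: "N \<lhd> G" and y: "y \<in> UNIV \<rightarrow> carrier G"
    and const: "\<And>x. x \<in> coset_class t N y I \<Longrightarrow> ceval G t x = c"
    and j: "j \<in> vars t" "j \<notin> I" and x: "x \<in> coset_class t N y (insert j I)"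
  shows "ceval G t x = \<one>"
proof -
  interpret N: normal N G by fact
  let ?z = "x(j := y j)"
  have xG: "x \<in> UNIV \<rightarrow> carrier G" and xj: "x j \<in> N"
    using x j by (auto simp: coset_class_def Pi_iff)
  have yG: "y i \<in> carrier G" for i using y by auto
  have y_in: "y j \<in> y j <# N"
    using mem_l_coset_iff[OF N.subgroup_axioms yG yG] yG by simp
  have z: "?z \<in> coset_class t N y I"
    using x j y y_in by (auto simp: coset_class_def Pi_iff)
  have yx: "y j \<otimes> x j \<in> y j <# N" "y j \<otimes> x j \<in> carrier G"
    using xj y xG by (auto simp: l_coset_def)
  then have z': "x(j := y j \<otimes> x j) \<in> coset_class t N y I"
    using x j by (auto simp: coset_class_def Pi_iff)
  obtain h where h: "h \<in> UNIV \<rightarrow> N" "ceval G t (x(j := y j \<otimes> x j)) =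
      ceval G t (\<lambda>i. conjugate (h i) (?z i)) \<otimes> ceval G t (x(j := x j))"
    using ceval_mult[OF t j(1) N _ xj xG, of "y j"] y by auto
  have hN: "h i \<in> N" for i using h(1) by auto
  then have hG: "h i \<in> carrier G" for i by auto
  have zG: "?z i \<in> carrier G" for i using xG y by auto
  have "(\<lambda>i. conjugate (h i) (?z i)) \<in> coset_class t N y I"
    unfolding coset_class_def
  proof (intro CollectI conjI ballI)
    show "(\<lambda>i. conjugate (h i) (?z i)) \<in> UNIV \<rightarrow> carrier G"
      using hG zG by (intro Pi_I conjugate_closed) auto
    show "conjugate (h i) (?z i) \<in> N" if "i \<in> vars t \<inter> I" for i
      using z that by (intro normal_conjugate_closed[OF N hG]) (auto simp: coset_class_def)
    show "conjugate (h i) (?z i) \<in> y i <# N" if "i \<in> vars t - I" for i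
      using z that y by (intro conjugate_mem_l_coset[OF N _ _ hN]) (auto simp: coset_class_def)
  qed
  then have "c = c \<otimes> ceval G t x"
    using h(2) unfolding const[OF z'] by (simp only: const fun_upd_triv)
  moreover have "c \<in> carrier G" using const[OF z] ceval_closed[of ?z t] xG y by (auto simp: Pi_iff)
  moreover have "ceval G t x \<in> carrier G" using xG by simp
  ultimately show ?thesis by (simp add: r_cancel_one')
qed

text \<open>Variables move from their cosets into \<open>N\<close> one after another. The first move
  turns the constant \<open>c\<close> into \<open>\<one>\<close>, and each later move repeats the
  argument with the constant \<open>\<one>\<close>.\<close>

lemma ceval_constant_on_cosets:
  assumes t: "multilinear t" and N: "N \<lhd> G" and y: "y \<in> UNIV \<rightarrow> carrier G"
    and const: "\<And>x. x \<in> coset_class t N y {} \<Longrightarrow> ceval G t x = c"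
    and I: "I \<subseteq> vars t" "I \<noteq> {}" and x: "x \<in> coset_class t N y I"
  shows "ceval G t x = \<one>"
proof -
  have "finite I" using I finite_subset[OF _ finite_vars] by blast
  then show ?thesis
    using I(2,1) x
  proof (induction I arbitrary: x rule: finite_ne_induct)
    case (singleton j)
    show ?case
      by (rule ceval_constant_insert[OF t N y const, where I = "{}" and j = j]) (use singleton in auto)
  next
    case (insert j I)
    show ?case
      by (rule ceval_constant_insert[OF t N y insert.IH, where I = I and j = j]) (use insert in auto)
  qed
qed

text \<open>This is \<open>ceval_mult\<close> with \<open>G\<close> as the normal subgroup: nothing
  is known about the conjugators in the extra factor, so that factor has to vanish for all of
  them.\<close>

lemma ceval_left_mult:
  assumes t: "multilinear t" "i \<in> vars t" and x: "x \<in> UNIV \<rightarrow> carrier G" and n: "n \<in> carrier G"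
    and one: "\<And>h. h \<in> UNIV \<rightarrow> carrier G \<Longrightarrow> ceval G t (\<lambda>j. conjugate (h j) ((x(i := n)) j)) = \<one>"
  shows "ceval G t (x(i := n \<otimes> x i)) = ceval G t x"
proof -
  have "x i \<in> carrier G" using x by auto
  then obtain h where h: "h \<in> UNIV \<rightarrow> carrier G" "ceval G t (x(i := n \<otimes> x i)) =
      ceval G t (\<lambda>j. conjugate (h j) ((x(i := n)) j)) \<otimes> ceval G t (x(i := x i))"
    using ceval_mult[OF t normal_self n _ x, of "x i"] by blast
  then show ?thesis using one[OF h(1)] x by simp
qed

text \<open>Multiplying an argument in \<open>I\<close> by an element of \<open>N\<close> adds a
  factor killed by \<open>one\<close>; normality protects the hypotheses of \<open>one\<close>
  against the conjugators. For \<open>I = vars t\<close> the word descends to the quotient by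
  \<open>N\<close>.\<close>

lemma ceval_coset_invariant:
  assumes t: "multilinear t" and N: "N \<lhd> G" and I: "I \<subseteq> vars t"
    and one: "\<And>i x. i \<in> I \<Longrightarrow> x \<in> UNIV \<rightarrow> carrier G \<Longrightarrow>
      (\<And>j. j \<in> insert i (vars t - I) \<Longrightarrow> x j \<in> N) \<Longrightarrow> ceval G t x = \<one>"
    and x: "x \<in> UNIV \<rightarrow> carrier G" and y: "y \<in> UNIV \<rightarrow> carrier G"
    and N_x: "\<And>j. j \<in> vars t - I \<Longrightarrow> x j \<in> N"
    and xy: "\<And>j. j \<in> vars t - I \<Longrightarrow> x j = y j" "\<And>i. i \<in> I \<Longrightarrow> y i \<in> N #> x i"
  shows "ceval G t y = ceval G t x"
proof -
  interpret N: normal N G by fact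
  define A where "A j = (if j \<in> vars t - I then N else carrier G)" for j
  define y' where "y' j = (if j \<in> I then y j else x j)" for j
  have AG: "A j \<subseteq> carrier G" for j using N.subset by (auto simp: A_def)
  have "ceval G t y' = ceval G t x"
  proof (rule finite_coordinate_change[where f = "ceval G t" and x = x and y = y' and I = I
        and A = A and r = "\<lambda>_ a b. b \<in> N #> a"])
    show "finite I" using I finite_subset[OF _ finite_vars] by blast
    show "x j \<in> A j" "y' j \<in> A j" for j
      using x y N_x by (auto simp: A_def y'_def)
    fix x i b assume x: "\<And>j. x j \<in> A j" and i: "i \<in> I" and b: "b \<in> A i" "b \<in> N #> x i"
    have xG: "x j \<in> carrier G" for j using x AG by blast
    obtain n where n: "n \<in> N" "b = n \<otimes> x i" using b by (auto simp: r_coset_def)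
    have "ceval G t (x(i := n \<otimes> x i)) = ceval G t x"
    proof (rule ceval_left_mult[OF t])
      show "i \<in> vars t" using i I by blast
      fix h :: "nat \<Rightarrow> 'a" assume h: "h \<in> UNIV \<rightarrow> carrier G"
      then have hG: "h j \<in> carrier G" for j by auto
      show "ceval G t (\<lambda>j. conjugate (h j) ((x(i := n)) j)) = \<one>"
      proof (rule one[OF i])
        show "(\<lambda>j. conjugate (h j) ((x(i := n)) j)) \<in> UNIV \<rightarrow> carrier G"
          using hG xG n by (intro Pi_I conjugate_closed) auto
        show "conjugate (h j) ((x(i := n)) j) \<in> N" if "j \<in> insert i (vars t - I)" for j
          using that x[of j] n i by (intro normal_conjugate_closed[OF N hG]) (auto simp: A_def)
      qed
    qed (use xG n in auto)
    then show "ceval G t (x(i := b)) = ceval G t x" using n by simp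
  qed (use xy in \<open>auto simp: y'_def\<close>)
  moreover have "ceval G t y' = ceval G t y"
    using xy by (intro ceval_cong) (auto simp: y'_def)
  ultimately show ?thesis by simp
qed

end

section \<open>Torsion and Schur's theorem\<close>

lemma finite_image_factor:
  assumes "finite (g ` A)" "\<And>x y. x \<in> A \<Longrightarrow> y \<in> A \<Longrightarrow> g x = g y \<Longrightarrow> f x = f y"
  shows "finite (f ` A)"
proof -
  have "f ` A \<subseteq> (\<lambda>z. f (SOME x. x \<in> A \<and> g x = z)) ` g ` A"
  proof
    fix y assume "y \<in> f ` A"
    then obtain x where x: "x \<in> A" "y = f x" by blast
    then have "(SOME x'. x' \<in> A \<and> g x' = g x) \<in> A \<and> g (SOME x'. x' \<in> A \<and> g x' = g x) = g x"
      by (intro someI[of "\<lambda>x'. x' \<in> A \<and> g x' = g x" x]) auto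
    then have "y = f (SOME x'. x' \<in> A \<and> g x' = g x)"
      using assms(2) x by metis
    then show "y \<in> (\<lambda>z. f (SOME x. x \<in> A \<and> g x = z)) ` g ` A" using x by blast
  qed
  then show ?thesis using assms(1) finite_subset by blast
qed

context group
begin

definition torsion :: "'a \<Rightarrow> bool" where
  "torsion g \<longleftrightarrow> (\<exists>n > 0. g [^] (n :: nat) = \<one>)"

lemma pow_commutes:
  "x \<in> carrier G \<Longrightarrow> x \<otimes> x [^] (n :: nat) = x [^] n \<otimes> x"
  "x \<in> carrier G \<Longrightarrow> y \<in> carrier G \<Longrightarrow> x \<otimes> (x [^] n \<otimes> y) = x [^] n \<otimes> (x \<otimes> y)"
  using nat_pow_Suc2[of x n] by (simp_all add: m_assoc[symmetric])

definition list_prod :: "'a list \<Rightarrow> 'a" where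
  "list_prod xs = foldr (\<otimes>) xs \<one>"

lemma list_prod_simps [simp]:
  "list_prod [] = \<one>" "list_prod (x # xs) = x \<otimes> list_prod xs"
  by (simp_all add: list_prod_def)

lemma list_prod_closed [simp]: "set xs \<subseteq> carrier G \<Longrightarrow> list_prod xs \<in> carrier G"
  by (induction xs) auto

lemma list_prod_append:
  "set xs \<subseteq> carrier G \<Longrightarrow> set ys \<subseteq> carrier G \<Longrightarrow>
    list_prod (xs @ ys) = list_prod xs \<otimes> list_prod ys"
  by (induction xs) (auto simp: m_assoc)

lemma list_prod_replicate:
  "x \<in> carrier G \<Longrightarrow> list_prod (replicate n x) = x [^] n"
  by (induction n) (auto simp: pow_commutes)

lemma conjugate_pow:
  "h \<in> carrier G \<Longrightarrow> a \<in> carrier G \<Longrightarrow> conjugate h (a [^] n) = conjugate h a [^] (n :: nat)"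
proof (induction n)
  case 0
  then show ?case by (simp add: conjugate_def)
next
  case (Suc n)
  then show ?case by (simp add: conjugate_mult)
qed

lemma finite_mult_closed_torsion:
  assumes "finite P" "P \<subseteq> carrier G" "\<And>a b. a \<in> P \<Longrightarrow> b \<in> P \<Longrightarrow> a \<otimes> b \<in> P" "p \<in> P"
  shows "torsion p"
proof -
  have pG: "p \<in> carrier G" using assms by blast
  have "p [^] Suc n \<in> P" for n
    by (induction n) (use assms pG in auto)
  then have "range (\<lambda>n. p [^] Suc n) \<subseteq> P" by blast
  then have "finite (range (\<lambda>n. p [^] Suc n))" using assms(1) by (rule finite_subset)
  then have "\<not> inj (\<lambda>n. p [^] Suc n)" using finite_imageD infinite_UNIV_nat by blast
  then obtain i j where "i < j" "p [^] Suc i = p [^] Suc j"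
    unfolding inj_def by (metis linorder_neqE_nat)
  then have "p [^] (j - i) = \<one>" using pow_eq_div2[OF pG, of "Suc j" "Suc i"] by simp
  then show ?thesis unfolding torsion_def using \<open>i < j\<close> by (intro exI[of _ "j - i"]) auto
qed

text \<open>Pulling \<open>x\<close> leftwards past a letter replaces that letter by a conjugate,
  which is again in \<open>X\<close>, so the total length is preserved.\<close>

lemma list_prod_collect:
  assumes X: "X \<subseteq> carrier G" "\<And>g a. g \<in> carrier G \<Longrightarrow> a \<in> X \<Longrightarrow> conjugate g a \<in> X"
    and "x \<in> X" "set ys \<subseteq> X" "k \<le> count_list ys x"
  shows "\<exists>zs. set zs \<subseteq> X \<and> length zs + k = length ys \<and> list_prod ys = x [^] k \<otimes> list_prod zs"
  using assms(4,5)
proof (induction ys arbitrary: k)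
  case Nil
  then show ?case by (intro exI[of _ "[]"]) simp
next
  case (Cons y ys)
  have xG: "x \<in> carrier G" and yG: "y \<in> carrier G" using X(1) assms(3) Cons.prems by auto
  have subG: "set zs \<subseteq> X \<Longrightarrow> set zs \<subseteq> carrier G" for zs using X(1) by blast
  show ?case
  proof (cases "y = x \<and> k > 0")
    case True
    then obtain k' where k: "k = Suc k'" by (cases k) auto
    then obtain zs where zs: "set zs \<subseteq> X" "length zs + k' = length ys"
        "list_prod ys = x [^] k' \<otimes> list_prod zs"
      using Cons.IH[of k'] Cons.prems True by auto
    then have "list_prod (y # ys) = x [^] k \<otimes> list_prod zs"
      using True k xG subG by (simp add: pow_commutes m_assoc)
    then show ?thesis using zs k by (intro exI[of _ zs]) auto
  next
    case False
    then have "k \<le> count_list ys x" using Cons.prems by (auto split: if_splits)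
    then obtain zs where zs: "set zs \<subseteq> X" "length zs + k = length ys"
        "list_prod ys = x [^] k \<otimes> list_prod zs"
      using Cons.IH[of k] Cons.prems by auto
    have "list_prod (y # ys) = x [^] k \<otimes> list_prod (conjugate (x [^] k) y # zs)"
      using zs xG yG subG by (simp add: conjugate_def m_assoc)
    moreover have "conjugate (x [^] k) y \<in> X" using Cons.prems xG by (intro X(2)) auto
    ultimately show ?thesis
      using zs by (intro exI[of _ "conjugate (x [^] k) y # zs"]) auto
  qed
qed

text \<open>Powers of a generator that occur often enough in a product can be collected and replaced by
  shorter products, which bounds the length of the products that have to be considered.\<close>

lemma finite_generate_if_short_powers:
  assumes X: "finite X" "X \<subseteq> carrier G" "\<And>g a. g \<in> carrier G \<Longrightarrow> a \<in> X \<Longrightarrow> conjugate g a \<in> X"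
    and short: "\<And>x. x \<in> X \<Longrightarrow> \<exists>m zs. set zs \<subseteq> X \<and> length zs < m \<and> x [^] m = list_prod zs"
  shows "finite (generate G X)"
proof -
  obtain m r where mr: "\<And>x. x \<in> X \<Longrightarrow> set (r x) \<subseteq> X"
      "\<And>x. x \<in> X \<Longrightarrow> length (r x) < m x" "\<And>x. x \<in> X \<Longrightarrow> x [^] (m x :: nat) = list_prod (r x)"
    using short by metis
  \<comment> \<open>By counting letters, a product of more than \<open>sum m X\<close> letters
    contains some \<open>x\<close> at least \<open>m x\<close> times; collecting these and
    substituting \<open>r x\<close> shortens it.\<close>
  define B where "B = sum m X"
  have bound: "\<exists>zs. set zs \<subseteq> X \<and> length zs \<le> B \<and> list_prod zs = list_prod ys" if "set ys \<subseteq> X" for ys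
    using that
  proof (induction ys rule: length_induct)
    case (1 ys)
    show ?case
    proof (cases "length ys \<le> B")
      case False
      have "\<exists>x \<in> X. m x \<le> count_list ys x"
      proof (rule ccontr)
        assume "\<not> ?thesis"
        then have "sum (count_list ys) X \<le> sum m X" by (intro sum_mono) force
        then show False using False sum_count_set[OF 1(2) X(1)] by (simp add: B_def)
      qed
      then obtain x where x: "x \<in> X" "m x \<le> count_list ys x" by blast
      then obtain zs where zs: "set zs \<subseteq> X" "length zs + m x = length ys"
          "list_prod ys = x [^] m x \<otimes> list_prod zs"
        using list_prod_collect[OF X(2,3) x(1) 1(2) x(2)] by blast
      have "list_prod (r x @ zs) = list_prod ys"
        using zs(1,3) mr(1,3)[OF x(1)] X(2) by (subst list_prod_append) auto
      moreover have "length (r x @ zs) < length ys" "set (r x @ zs) \<subseteq> X"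
        using zs mr(1,2)[OF x(1)] by auto
      ultimately show ?thesis using 1(1) by metis
    qed (use 1 in blast)
  qed
  \<comment> \<open>Products without inverses. Once \<open>P\<close> is known to be finite and
    multiplicatively closed, its elements are torsion, so inverses of generators are powers.\<close>
  define P where "P = list_prod ` {ys. set ys \<subseteq> X}"
  have "P \<subseteq> list_prod ` {ys. set ys \<subseteq> X \<and> length ys \<le> B}"
    unfolding P_def using bound by (fastforce simp: image_iff)
  then have "finite P" using finite_lists_length_le[OF X(1)] finite_subset by blast
  have PG: "P \<subseteq> carrier G" using X(2) by (auto simp: P_def)
  have P_mult: "a \<otimes> b \<in> P" if ab: "a \<in> P" "b \<in> P" for a b
  proof -
    obtain ys zs where "set ys \<subseteq> X" "a = list_prod ys" "set zs \<subseteq> X" "b = list_prod zs"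
      using ab unfolding P_def by blast
    moreover then have "a \<otimes> b = list_prod (ys @ zs)" using X(2) by (subst list_prod_append) auto
    ultimately show ?thesis by (auto simp: P_def)
  qed
  have P_one: "\<one> \<in> P" by (force simp: P_def intro: image_eqI[of _ _ "[]"])
  have XP: "x \<in> P" if "x \<in> X" for x
    using that X(2) by (auto simp: P_def intro!: image_eqI[of _ _ "[x]"])
  have P_inv: "inv x \<in> P" if x: "x \<in> X" for x
  proof -
    have xG: "x \<in> carrier G" using x X by blast
    obtain n where n: "n > 0" "x [^] (n :: nat) = \<one>"
      using finite_mult_closed_torsion[OF \<open>finite P\<close> PG P_mult XP[OF x]] by (auto simp: torsion_def)
    then have "x [^] (n - 1) \<otimes> x = \<one>" using nat_pow_Suc[of x "n - 1"] by simp
    then have "inv x = x [^] (n - 1)" using xG by (intro inv_equality) auto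
    moreover have "x [^] k \<in> P" for k :: nat
      by (induction k) (auto intro: P_one P_mult XP x)
    ultimately show ?thesis by simp
  qed
  have "generate G X \<subseteq> P"
  proof
    fix g assume "g \<in> generate G X"
    then show "g \<in> P"
      by induction (auto intro: P_one P_mult P_inv XP)
  qed
  then show ?thesis using \<open>finite P\<close> finite_subset by blast
qed

text \<open>Dietzmann's lemma: a trivial power is the empty product, which is as short as
  possible.\<close>

lemma finite_generate_if_torsion:
  assumes "finite X" "X \<subseteq> carrier G" "\<And>g a. g \<in> carrier G \<Longrightarrow> a \<in> X \<Longrightarrow> conjugate g a \<in> X"
    and "\<And>x. x \<in> X \<Longrightarrow> torsion x"
  shows "finite (generate G X)"
proof (rule finite_generate_if_short_powers[OF assms(1-3)])
  fix x assume "x \<in> X"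
  then obtain n where "n > 0" "x [^] (n :: nat) = \<one>" using assms(4) by (auto simp: torsion_def)
  then show "\<exists>m zs. set zs \<subseteq> X \<and> length zs < m \<and> x [^] m = list_prod zs"
    by (intro exI[of _ n] exI[of _ "[]"]) auto
qed

lemma pow_index_mem:
  assumes N: "N \<lhd> G" "finite (rcosets N)" and g: "g \<in> carrier G"
  shows "g [^] card (rcosets N) \<in> N"
proof -
  interpret N: normal N G by fact
  interpret Q: group "G Mod N" by (rule N.factorgroup_is_group)
  interpret \<pi>: group_hom G "G Mod N" "\<lambda>a. N #> a"
    by unfold_locales (rule N.r_coset_hom_Mod)
  have "N #> (g [^] card (rcosets N)) = (N #> g) [^]\<^bsub>G Mod N\<^esub> card (rcosets N)"
    using g by (rule \<pi>.hom_nat_pow)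
  also have "\<dots> = \<one>\<^bsub>G Mod N\<^esub>"
    using Q.pow_order_eq_1[of "N #> g"] \<pi>.hom_closed[OF g] by (simp add: order_def FactGroup_def)
  finally have "N #> (g [^] card (rcosets N)) = N" by (simp add: FactGroup_def)
  then show ?thesis using g coset_join1 N.subgroup_axioms by blast
qed

lemma same_rcosetE:
  assumes "subgroup N G" "a \<in> carrier G" "b \<in> carrier G" "N #> a = N #> b"
  obtains n where "n \<in> N" "n \<in> carrier G" "b = n \<otimes> a"
proof -
  have "b \<in> N #> a" using assms rcos_self by blast
  then show thesis
    using that subgroup.mem_carrier[OF assms(1)] by (auto simp: r_coset_def)
qed

lemma finite_rcosets_image:
  assumes "subgroup N G" "finite (rcosets N)" "A \<subseteq> carrier G"
    and "\<And>a n. a \<in> A \<Longrightarrow> n \<in> N \<Longrightarrow> n \<in> carrier G \<Longrightarrow> n \<otimes> a \<in> A \<Longrightarrow> f (n \<otimes> a) = f a"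
  shows "finite (f ` A)"
proof (rule finite_image_factor[where g = "\<lambda>a. N #> a"])
  have "(\<lambda>a. N #> a) ` A \<subseteq> rcosets N"
    using assms(3) by (auto simp: RCOSETS_def)
  then show "finite ((\<lambda>a. N #> a) ` A)" using assms(2) finite_subset by blast
  fix a b assume "a \<in> A" "b \<in> A" "N #> a = N #> b"
  then show "f a = f b" using same_rcosetE[OF assms(1), of a b] assms(3,4) by (metis subsetD)
qed

lemma torsion_conjugate:
  assumes "torsion a" "a \<in> carrier G" "g \<in> carrier G"
  shows "torsion (conjugate g a)"
proof -
  obtain n where "n > 0" "a [^] (n :: nat) = \<one>" using assms by (auto simp: torsion_def)
  moreover then have "conjugate g a [^] n = \<one>"
    using conjugate_pow[of g a n] assms by (simp add: conjugate_def)
  ultimately show ?thesis by (auto simp: torsion_def)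
qed

section \<open>Normal subgroups centralised by a normal subgroup of finite index\<close>

context
  fixes N H
  assumes N: "N \<lhd> G" "finite (rcosets N)" and H: "H \<lhd> G"
    and centralizes: "\<And>n h. n \<in> N \<Longrightarrow> h \<in> H \<Longrightarrow> n \<otimes> h = h \<otimes> n"
begin

interpretation N: normal N G by (rule N(1))
interpretation H: normal H G by (rule H)

text \<open>As \<open>N\<close> centralises \<open>H\<close>, a commutator of elements of
  \<open>H\<close> depends only on their cosets modulo \<open>N\<close>. Note that
  \<open>derived_set\<close> uses \<open>a b a\<inverse> b\<inverse>\<close>, unlike
  \<open>commutator\<close>.\<close>

lemma finite_derived_set: "finite (derived_set G H)"
proof -
  let ?f = "\<lambda>a b. a \<otimes> b \<otimes> inv a \<otimes> inv b"
  let ?r = "\<lambda>(a, b). (N #> a, N #> b)"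
  have "?r ` (H \<times> H) \<subseteq> (rcosets N) \<times> (rcosets N)" using rcosetsI[OF N.subset] by auto
  then have fin: "finite (?r ` (H \<times> H))" using N(2) finite_subset by blast
  have "?f a b = ?f a' b'"
    if ab: "a \<in> H" "b \<in> H" "a' \<in> H" "b' \<in> H" and eq: "N #> a = N #> a'" "N #> b = N #> b'"
    for a b a' b'
  proof -
    obtain n where n: "n \<in> N" "a' = n \<otimes> a"
      using same_rcosetE[OF N.subgroup_axioms _ _ eq(1)] ab by auto
    obtain k where k: "k \<in> N" "b' = k \<otimes> b"
      using same_rcosetE[OF N.subgroup_axioms _ _ eq(2)] ab by auto
    have "?f a' b' = n \<otimes> (a \<otimes> b' \<otimes> inv a) \<otimes> inv n \<otimes> inv b'"
      using n k ab by (simp add: group_normalize)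
    also have "\<dots> = ?f a b'"
      using n ab centralizes[of n "a \<otimes> b' \<otimes> inv a"] by (simp add: group_normalize)
    also have "\<dots> = (a \<otimes> k) \<otimes> b \<otimes> inv a \<otimes> inv b \<otimes> inv k"
      using k ab by (simp add: group_normalize)
    also have "a \<otimes> k = k \<otimes> a" using k ab centralizes by simp
    also have "k \<otimes> a \<otimes> b \<otimes> inv a \<otimes> inv b \<otimes> inv k = k \<otimes> ?f a b \<otimes> inv k"
      using k ab by (simp add: group_normalize)
    also have "\<dots> = ?f a b"
      using k ab centralizes[of k "?f a b"] by (simp add: group_normalize)
    finally show ?thesis ..
  qed
  then have inv: "(case p of (a, b) \<Rightarrow> ?f a b) = (case q of (a, b) \<Rightarrow> ?f a b)"
    if "p \<in> H \<times> H" "q \<in> H \<times> H" "?r p = ?r q" for p q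
    using that unfolding case_prod_unfold mem_Times_iff prod.inject by blast
  have "finite ((\<lambda>(a, b). ?f a b) ` (H \<times> H))"
    by (rule finite_image_factor[where g = ?r, OF fin inv])
  moreover have "derived_set G H \<subseteq> (\<lambda>(a, b). ?f a b) ` (H \<times> H)" by auto
  ultimately show ?thesis by (rule finite_subset[rotated])
qed

text \<open>Schur's theorem: with \<open>c = a b a\<inverse> b\<inverse>\<close> and \<open>c\<^sup>n\<close> centralised by \<open>b\<close>, the power \<open>c\<^sup>n\<^sup>+\<^sup>1\<close> is
  the product of the commutator of \<open>a\<close>, \<open>b\<^sup>2\<close> and of \<open>n - 1\<close> copies of \<open>b c b\<inverse>\<close>.\<close>

lemma finite_derived: "finite (derived G H)"
  unfolding derived_def
proof (rule finite_generate_if_short_powers[OF finite_derived_set])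
  let ?f = "\<lambda>a b. a \<otimes> b \<otimes> inv a \<otimes> inv b"
  show "derived_set G H \<subseteq> carrier G" by (rule derived_set_in_carrier) auto
  have conj: "conjugate g (?f a b) = ?f (conjugate g a) (conjugate g b)"
    if "g \<in> carrier G" "a \<in> carrier G" "b \<in> carrier G" for a b g
    using that by (simp add: conjugate_def group_normalize)
  show conj_mem: "conjugate g c \<in> derived_set G H" if g: "g \<in> carrier G" and "c \<in> derived_set G H" for g c
  proof -
    obtain a b where ab: "a \<in> H" "b \<in> H" "c = ?f a b" using \<open>c \<in> _\<close> by auto
    then have "conjugate g c = ?f (conjugate g a) (conjugate g b)" using g by (simp add: conj)
    then show ?thesis using ab g normal_conjugate_closed[OF H g] by blast
  qed
  fix c assume c: "c \<in> derived_set G H"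
  then obtain a b where ab: "a \<in> H" "b \<in> H" "c = ?f a b" by auto
  then have G: "a \<in> carrier G" "b \<in> carrier G" "c \<in> carrier G" by auto
  define n where "n = card (rcosets N)"
  have "rcosets N \<noteq> {}" by (auto simp: RCOSETS_def)
  then obtain k where k: "n = Suc k" using N(2) unfolding n_def by (metis card_0_eq not0_implies_Suc)
  have "c [^] n \<in> N" unfolding n_def using N G by (intro pow_index_mem) auto
  then have comm: "c [^] n \<otimes> inv b = inv b \<otimes> c [^] n" using ab by (intro centralizes) auto
  have "c [^] Suc n = c \<otimes> c [^] n" using G by (simp add: pow_commutes)
  also have "\<dots> = a \<otimes> b \<otimes> inv a \<otimes> (c [^] n \<otimes> inv b)"
    unfolding comm using G ab(3) by (simp add: m_assoc)
  \<comment> \<open>One \<open>c\<close> merges into the prefix: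
    \<open>a b a\<inverse> c = a b b a\<inverse> b\<inverse>\<close>, the commutator of
    \<open>a\<close> and \<open>b b\<close> followed by \<open>b\<close>. This \<open>b\<close> and
    the trailing \<open>b\<inverse>\<close> conjugate the remaining \<open>c [^] k\<close>, so
    \<open>n\<close> commutators replace \<open>n + 1\<close>.\<close>
  also have "c [^] n = c \<otimes> c [^] k" using G k by (simp add: pow_commutes)
  also have "a \<otimes> b \<otimes> inv a \<otimes> (c \<otimes> c [^] k \<otimes> inv b) = ?f a (b \<otimes> b) \<otimes> conjugate (inv b) (c [^] k)"
    using G ab(3) nat_pow_closed[OF G(3), of k] by (simp add: conjugate_def group_normalize)
  also have "\<dots> = list_prod (?f a (b \<otimes> b) # replicate k (conjugate (inv b) c))"
    using G by (simp add: conjugate_pow list_prod_replicate)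
  finally have "c [^] Suc n = \<dots>" .
  moreover have "set (?f a (b \<otimes> b) # replicate k (conjugate (inv b) c)) \<subseteq> derived_set G H"
  proof -
    have "?f a (b \<otimes> b) \<in> derived_set G H" using ab(1,2) H.m_closed by blast
    moreover have "conjugate (inv b) c \<in> derived_set G H" using c G by (intro conj_mem) auto
    ultimately show ?thesis by (simp only: list.set set_replicate_conv_if) auto
  qed
  moreover have "length (?f a (b \<otimes> b) # replicate k (conjugate (inv b) c)) < Suc n"
    using k by simp
  ultimately show "\<exists>m zs. set zs \<subseteq> derived_set G H \<and> length zs < m \<and> c [^] m = list_prod zs"
    by blast
qed

lemma torsion_if_derived: "g \<in> derived G H \<Longrightarrow> torsion g"
  using subgroup.m_closed[OF derived_is_subgroup[OF H.subset]]
    derived_in_carrier[OF H.subset] finite_derived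
  by (intro finite_mult_closed_torsion) auto

lemma finite_conjugates:
  assumes "a \<in> H"
  shows "finite ((\<lambda>g. conjugate g a) ` carrier G)"
proof (rule finite_rcosets_image[OF N.subgroup_axioms N(2)])
  fix g n assume gn: "g \<in> carrier G" "n \<in> N" "n \<in> carrier G"
  then have "conjugate (n \<otimes> g) a = conjugate g (inv n \<otimes> (n \<otimes> a))"
    using assms centralizes[of n a] by (simp add: conjugate_def group_normalize)
  then show "conjugate (n \<otimes> g) a = conjugate g a" using gn assms by simp
qed simp

text \<open>Closure under products is the point: \<open>a\<close> and \<open>b\<close> have finitely
  many conjugates, all torsion, so Dietzmann's lemma puts \<open>a \<otimes> b\<close> into a finite
  group.\<close>

lemma torsion_elements_normal: "{h \<in> H. torsion h} \<lhd> G"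
proof (rule normal_invI)
  show "subgroup {h \<in> H. torsion h} G"
  proof (rule subgroupI)
    show "{h \<in> H. torsion h} \<noteq> {}"
    proof -
      have "torsion \<one>" unfolding torsion_def by (intro exI[of _ 1]) simp
      then show ?thesis using H.one_closed by blast
    qed
  next
    fix a assume "a \<in> {h \<in> H. torsion h}"
    then show "inv a \<in> {h \<in> H. torsion h}"
      using nat_pow_inv[of a] by (auto simp: torsion_def)
  next
    fix a b assume ab: "a \<in> {h \<in> H. torsion h}" "b \<in> {h \<in> H. torsion h}"
    define X where "X = (\<lambda>g. conjugate g a) ` carrier G \<union> (\<lambda>g. conjugate g b) ` carrier G"
    have X: "X \<subseteq> carrier G" "a \<in> X" "b \<in> X"
      using ab by (auto simp: X_def intro!: image_eqI[of _ _ \<one>])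
    have "finite (generate G X)"
    proof (rule finite_generate_if_torsion[OF _ X(1)])
      show "finite X" unfolding X_def using ab by (intro finite_UnI finite_conjugates) auto
      show "conjugate g c \<in> X" if "g \<in> carrier G" "c \<in> X" for g c
        using that ab by (auto simp: X_def conjugate_conjugate)
      show "torsion c" if "c \<in> X" for c
        using that ab torsion_conjugate by (auto simp: X_def)
    qed
    moreover have "a \<otimes> b \<in> generate G X" using X by (intro generate.eng generate.incl)
    ultimately have "torsion (a \<otimes> b)"
      using generate_incl[OF X(1)] generate.eng[of _ G X]
      by (intro finite_mult_closed_torsion[of "generate G X"]) auto
    then show "a \<otimes> b \<in> {h \<in> H. torsion h}" using ab by auto
  qed auto
next
  fix x h assume "x \<in> carrier G" "h \<in> {h \<in> H. torsion h}"
  then show "x \<otimes> h \<otimes> inv x \<in> {h \<in> H. torsion h}"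
    using torsion_conjugate[of h "inv x"] normal_conjugate_closed[OF H, of "inv x" h]
    by (auto simp: conjugate_def)
qed

end

end

section \<open>Words with a marginal subgroup of finite index\<close>

lemma (in group_hom) ceval_hom:
  "x \<in> UNIV \<rightarrow> carrier G \<Longrightarrow> ceval H t (\<lambda>i. h (x i)) = h (ceval G t x)"
  by (induction t) (auto simp: commutator_def)

context group
begin

section \<open>Verbal subgroups and the derived series\<close>

lemma commutator_mult_right':
  assumes "a \<in> carrier G" "b \<in> carrier G" "c \<in> carrier G"
  shows "commutator G c (a \<otimes> b) = commutator G c b \<otimes> conjugate b (commutator G c a)"
  using assms by (simp add: commutator_def conjugate_def group_normalize)

lemma commutator_mult_left':
  assumes "a \<in> carrier G" "b \<in> carrier G" "c \<in> carrier G"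
  shows "commutator G (a \<otimes> b) c = conjugate b (commutator G a c) \<otimes> commutator G b c"
  using assms by (simp add: commutator_def conjugate_def group_normalize)

lemma commutator_inv_right:
  assumes "a \<in> carrier G" "c \<in> carrier G"
  shows "commutator G c (inv a) = conjugate (inv a) (inv (commutator G c a))"
  using assms by (simp add: commutator_def conjugate_def group_normalize)

lemma commutator_inv_left:
  assumes "a \<in> carrier G" "c \<in> carrier G"
  shows "commutator G (inv a) c = conjugate (inv a) (inv (commutator G a c))"
  using assms by (simp add: commutator_def conjugate_def group_normalize)

text \<open>Normality of \<open>W\<close> absorbs the conjugations in the commutator identities. The
  second entry is built up first, against a fixed generator, and then the first entry.\<close>

lemma commutator_generate:
  assumes W: "W \<lhd> G" and A: "A \<subseteq> carrier G" and B: "B \<subseteq> carrier G"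
    and AB: "\<And>a b. a \<in> A \<Longrightarrow> b \<in> B \<Longrightarrow> commutator G a b \<in> W"
    and a: "a \<in> generate G A" and b: "b \<in> generate G B"
  shows "commutator G a b \<in> W"
proof -
  interpret W: normal W G by fact
  have bG: "b \<in> carrier G" using b generate_in_carrier[OF B] by blast
  have *: "commutator G a b \<in> W" if "a \<in> A" for a
    using b
  proof induction
    case one
    then show ?case using that A by (auto simp: commutator_def)
  next
    case (incl b)
    then show ?case using AB that by blast
  next
    case (inv b)
    then have "a \<in> carrier G" "b \<in> carrier G" using that A B by auto
    then show ?case
      using AB[OF that inv] by (simp add: commutator_inv_right normal_conjugate_closed[OF W])
  next
    case (eng b b')
    then have "a \<in> carrier G" "b \<in> carrier G" "b' \<in> carrier G"
      using that A generate_in_carrier[OF B] by auto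
    then show ?case
      using eng.IH by (simp add: commutator_mult_right' normal_conjugate_closed[OF W])
  qed
  show ?thesis
    using a
  proof induction
    case one
    then show ?case using bG by (simp add: commutator_def)
  next
    case (incl a)
    then show ?case using * by blast
  next
    case (inv a)
    then have "a \<in> carrier G" using A by auto
    then show ?case
      using *[OF inv] bG by (simp add: commutator_inv_left normal_conjugate_closed[OF W])
  next
    case (eng a a')
    then have "a \<in> carrier G" "a' \<in> carrier G" using generate_in_carrier[OF A] by auto
    then show ?case
      using eng.IH bG by (simp add: commutator_mult_left' normal_conjugate_closed[OF W])
  qed
qed

definition outer_values :: "outer_commutator \<Rightarrow> 'a set" where
  "outer_values t = ceval G t ` (UNIV \<rightarrow> carrier G)"

lemma outer_values_closed: "outer_values t \<subseteq> carrier G"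
  by (auto simp: outer_values_def)

lemma conjugate_outer_values:
  assumes "g \<in> carrier G" "a \<in> outer_values t"
  shows "conjugate g a \<in> outer_values t"
proof -
  obtain x where x: "x \<in> UNIV \<rightarrow> carrier G" "a = ceval G t x"
    using assms by (auto simp: outer_values_def)
  have "conjugate g a = ceval G t (\<lambda>i. conjugate g (x i))"
    using ceval_conjugate[OF x(1) assms(1)] x(2) by simp
  moreover have "(\<lambda>i. conjugate g (x i)) \<in> UNIV \<rightarrow> carrier G"
    using x assms by (auto simp: Pi_iff)
  ultimately show ?thesis by (auto simp: outer_values_def)
qed

lemma generate_outer_values_normal: "generate G (outer_values t) \<lhd> G"
proof (rule normal_generateI[OF outer_values_closed])
  fix h g assume "h \<in> outer_values t" "g \<in> carrier G"
  then show "g \<otimes> h \<otimes> inv g \<in> outer_values t"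
    using conjugate_outer_values[of "inv g" h t] by (simp add: conjugate_def)
qed

abbreviation derived_series :: "nat \<Rightarrow> 'a set" where
  "derived_series k \<equiv> (derived G ^^ k) (carrier G)"

lemma derived_series_normal: "derived_series k \<lhd> G"
  by (induction k) (auto intro: normal_self derived_is_normal)

lemma derived_series_antimono: "k \<le> l \<Longrightarrow> derived_series l \<subseteq> derived_series k"
proof (induction l rule: dec_induct)
  case (step l)
  have "derived_series (Suc l) \<subseteq> derived_series l"
    using derived_incl[OF order_refl] derived_series_normal[of l] normal_imp_subgroup by auto
  then show ?case using step.IH by blast
qed simp

text \<open>At \<open>Comm s t\<close>, a term deep enough for both sides has its commutators in
  \<open>[S, T]\<close>, where \<open>S\<close>, \<open>T\<close> are generated by the values of
  \<open>s\<close>, \<open>t\<close>. Commutators of such values are values of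
  \<open>Comm s t\<close>, since assignments on disjoint variables can be glued.\<close>

lemma derived_series_subset_generate_outer_values:
  assumes "multilinear t"
  shows "\<exists>k. derived_series k \<subseteq> generate G (outer_values t)"
  using assms
proof (induction t)
  case (Var i)
  have "carrier G \<subseteq> outer_values (Var i)"
    by (auto simp: outer_values_def intro!: image_eqI[of _ _ "\<lambda>_. _"])
  then show ?case by (intro exI[of _ 0]) (auto intro: generate.incl)
next
  case (Comm s t)
  let ?W = "generate G (outer_values (Comm s t))"
  obtain k l where kl: "derived_series k \<subseteq> generate G (outer_values s)"
      "derived_series l \<subseteq> generate G (outer_values t)"
    using Comm by auto
  define q where "q = max k l"
  have sub: "derived_series q \<subseteq> generate G (outer_values s)" "derived_series q \<subseteq> generate G (outer_values t)"
    using kl derived_series_antimono[of k q] derived_series_antimono[of l q] by (auto simp: q_def)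
  have "derived_set G (derived_series q) \<subseteq> ?W"
  proof
    fix c assume "c \<in> derived_set G (derived_series q)"
    then obtain a b where ab: "a \<in> derived_series q" "b \<in> derived_series q"
        "c = a \<otimes> b \<otimes> inv a \<otimes> inv b" by auto
    interpret Dq: normal "derived_series q" G by (rule derived_series_normal)
    \<comment> \<open>The inverses translate between the conventions
      \<open>a b a\<inverse> b\<inverse>\<close> and
      \<open>a\<inverse> b\<inverse> a b\<close>.\<close>
    have "commutator G (inv a) (inv b) \<in> ?W"
    proof (rule commutator_generate[OF generate_outer_values_normal outer_values_closed outer_values_closed])
      show "inv a \<in> generate G (outer_values s)" "inv b \<in> generate G (outer_values t)"
        using ab sub by auto
      fix a b assume "a \<in> outer_values s" "b \<in> outer_values t"
      then obtain x y where xy: "x \<in> UNIV \<rightarrow> carrier G" "y \<in> UNIV \<rightarrow> carrier G"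
          "a = ceval G s x" "b = ceval G t y" by (auto simp: outer_values_def)
      let ?z = "\<lambda>i. if i \<in> vars s then x i else y i"
      have "ceval G s ?z = a" "ceval G t ?z = b"
        using xy Comm.prems by (auto intro!: ceval_cong)
      then have "commutator G a b = ceval G (Comm s t) ?z" by simp
      moreover have "?z \<in> UNIV \<rightarrow> carrier G" using xy by (auto simp: Pi_iff)
      ultimately have "commutator G a b \<in> outer_values (Comm s t)" by (auto simp: outer_values_def)
      then show "commutator G a b \<in> ?W" by (rule generate.incl)
    qed
    then show "c \<in> ?W" using ab by (simp add: commutator_def)
  qed
  then have "derived_series (Suc q) \<subseteq> ?W"
    using generate_subgroup_incl[OF _ generate_is_subgroup[OF outer_values_closed]]
    by (simp add: derived_def)
  then show ?case by blast
qed

lemma conjugate_mem_derived_rcoset: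
  assumes "K \<lhd> G" "h \<in> K" "u \<in> K"
  shows "conjugate h u \<in> derived G K #> u"
proof -
  interpret K: normal K G by fact
  have "inv h \<otimes> u \<otimes> inv (inv h) \<otimes> inv u \<in> derived_set G K"
    using assms K.m_inv_closed by blast
  then have "inv h \<otimes> u \<otimes> h \<otimes> inv u \<in> derived G K"
    using assms unfolding derived_def by (simp add: generate.incl)
  moreover have "conjugate h u = (inv h \<otimes> u \<otimes> h \<otimes> inv u) \<otimes> u"
    using assms by (simp add: conjugate_def m_assoc)
  ultimately show ?thesis by (auto simp: r_coset_def)
qed

text \<open>Downward induction on the position of the arguments in the derived series. Once all deeper
  values vanish, the word becomes multiplicative in an argument lying deepest in the series, so its
  values are torsion there.\<close>

lemma ceval_trivial_if_solvable:
  assumes t: "multilinear t" and d: "derived_series d \<subseteq> {\<one>}" and "m > 0"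
    and pow: "\<And>x i g. x \<in> UNIV \<rightarrow> carrier G \<Longrightarrow> i \<in> vars t \<Longrightarrow> g \<in> carrier G \<Longrightarrow>
      ceval G t (x(i := g [^] (m :: nat))) = \<one>"
    and torsion_free: "\<And>x. x \<in> UNIV \<rightarrow> carrier G \<Longrightarrow> torsion (ceval G t x) \<Longrightarrow> ceval G t x = \<one>"
    and x: "x \<in> UNIV \<rightarrow> carrier G"
  shows "ceval G t x = \<one>"
proof -
  have "ceval G t x = \<one>"
    if "x \<in> UNIV \<rightarrow> carrier G" "\<And>i. i \<in> vars t \<Longrightarrow> x i \<in> derived_series (k i)" for k x
    using that
  \<comment> \<open>The measure is the total depth still missing to \<open>d\<close>; once some
    \<open>k i\<close> reaches \<open>d\<close>, the argument \<open>x i\<close> is trivial.\<close>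
  proof (induction "\<Sum>i\<in>vars t. d - k i" arbitrary: k x rule: less_induct)
    case less
    have DG: "derived_series l \<subseteq> carrier G" for l
      using derived_series_antimono[of 0 l] by simp
    show ?case
    proof (cases "\<exists>i \<in> vars t. k i \<ge> d")
      case True
      then obtain i where i: "i \<in> vars t" "d \<le> k i" by blast
      then have "x i = \<one>" using less.prems(2)[OF i(1)] derived_series_antimono[OF i(2)] d by blast
      then show ?thesis using ceval_eq_one less.prems(1) i(1) by blast
    next
      case False
      define A where "A j = (if j \<in> vars t then derived_series (k j) else carrier G)" for j
      have AG: "A j \<subseteq> carrier G" and A_normal: "A j \<lhd> G" for j
        using DG derived_series_normal normal_self by (auto simp: A_def)
      have deeper: "ceval G t y = \<one>"
        if y: "\<And>j. y j \<in> A j" and i: "i \<in> vars t" "y i \<in> derived_series (Suc (k i))" for y i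
      proof (rule less.hyps[of "k(i := Suc (k i))"])
        show "(\<Sum>j\<in>vars t. d - (k(i := Suc (k i))) j) < (\<Sum>j\<in>vars t. d - k j)"
          using False i(1) by (intro sum_strict_mono_ex1) (auto intro!: bexI[of _ i])
        show "y \<in> UNIV \<rightarrow> carrier G" using y AG by blast
        show "y j \<in> derived_series ((k(i := Suc (k i))) j)" if "j \<in> vars t" for j
          using y[of j] i that by (auto simp: A_def)
      qed
      \<comment> \<open>Arguments matter only modulo the next derived term: a factor from that term
        contributes a value that is trivial by \<open>deeper\<close>.\<close>
      have invariant: "ceval G t y = ceval G t z"
        if z: "\<And>j. z j \<in> A j" and y: "\<And>j. y j \<in> A j"
          and yz: "\<And>j. j \<in> vars t \<Longrightarrow> y j \<in> derived_series (Suc (k j)) #> z j" for y z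
      proof -
        define y' where "y' j = (if j \<in> vars t then y j else z j)" for j
        have "ceval G t y' = ceval G t z"
        proof (rule finite_coordinate_change[where f = "ceval G t" and x = z and y = y' and
              I = "vars t" and A = A and r = "\<lambda>i a b. b \<in> derived_series (Suc (k i)) #> a"])
          show "z j \<in> A j" "y' j \<in> A j" for j using y z by (auto simp: y'_def)
          fix u i b assume u: "\<And>j. u j \<in> A j" and i: "i \<in> vars t" and b: "b \<in> A i"
            "b \<in> derived_series (Suc (k i)) #> u i"
          have uG: "u j \<in> carrier G" for j using u AG by blast
          obtain c where c: "c \<in> derived_series (Suc (k i))" "b = c \<otimes> u i"
            using b by (auto simp: r_coset_def)
          have cG: "c \<in> carrier G" using c(1) DG by blast
          have cA: "c \<in> A i" using c(1) i derived_series_antimono[of "k i" "Suc (k i)"] by (auto simp: A_def)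
          have "ceval G t (u(i := c \<otimes> u i)) = ceval G t u"
          proof (rule ceval_left_mult[OF t i _ cG])
            show "u \<in> UNIV \<rightarrow> carrier G" using uG by blast
            fix h :: "nat \<Rightarrow> 'a" assume "h \<in> UNIV \<rightarrow> carrier G"
            then have hG: "h j \<in> carrier G" for j by auto
            show "ceval G t (\<lambda>j. conjugate (h j) ((u(i := c)) j)) = \<one>"
            proof (rule deeper[OF _ i])
              show "conjugate (h j) ((u(i := c)) j) \<in> A j" for j
                using u cA by (intro normal_conjugate_closed[OF A_normal hG]) auto
              show "conjugate (h i) ((u(i := c)) i) \<in> derived_series (Suc (k i))"
                using c(1) by (intro normal_conjugate_closed[OF derived_series_normal hG]) auto
            qed
          qed
          then show "ceval G t (u(i := b)) = ceval G t u" using c by simp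
        qed (use yz in \<open>auto simp: y'_def\<close>)
        moreover have "ceval G t y' = ceval G t y" by (intro ceval_cong) (auto simp: y'_def)
        ultimately show ?thesis by simp
      qed
      have "finite (k ` vars t)" "k ` vars t \<noteq> {}" by auto
      then have "Max (k ` vars t) \<in> k ` vars t" by (rule Max_in)
      \<comment> \<open>With \<open>k i\<close> maximal, \<open>derived_series (k i)\<close> lies in
        the term of every variable. Conjugators from it move each argument within its coset modulo
        the next term, so \<open>invariant\<close> removes them and linearity results.\<close>
      then obtain i where i: "i \<in> vars t" "k i = Max (k ` vars t)" by (metis imageE)
      then have kmax: "k j \<le> k i" if "j \<in> vars t" for j using that by simp
      define y where "y j = (if j \<in> vars t then x j else \<one>)" for j
      have yA: "y j \<in> A j" for j using less.prems by (auto simp: y_def A_def)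
      have yG: "y \<in> UNIV \<rightarrow> carrier G" using yA AG by blast
      have linear: "ceval G t (y(i := a \<otimes> b)) = ceval G t (y(i := a)) \<otimes> ceval G t (y(i := b))"
        if a: "a \<in> derived_series (k i)" and b: "b \<in> derived_series (k i)" for a b
      proof -
        obtain h where h: "h \<in> UNIV \<rightarrow> derived_series (k i)" "ceval G t (y(i := a \<otimes> b)) =
            ceval G t (\<lambda>j. conjugate (h j) ((y(i := a)) j)) \<otimes> ceval G t (y(i := b))"
          using ceval_mult[OF t i(1) derived_series_normal _ b yG, of a] a DG by blast
        have hA: "h j \<in> A j" for j
          using h(1) kmax[of j] derived_series_antimono[of "k j" "k i"] DG by (auto simp: A_def)
        have zA: "(y(i := a)) j \<in> A j" for j using yA[of j] a i(1) by (auto simp: A_def)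
        have "ceval G t (\<lambda>j. conjugate (h j) ((y(i := a)) j)) = ceval G t (y(i := a))"
        proof (rule invariant[OF zA])
          show "conjugate (h j) ((y(i := a)) j) \<in> A j" for j
            using hA AG zA by (intro normal_conjugate_closed[OF A_normal]) auto
          show "conjugate (h j) ((y(i := a)) j) \<in> derived_series (Suc (k j)) #> (y(i := a)) j"
            if "j \<in> vars t" for j
            using conjugate_mem_derived_rcoset[OF A_normal hA zA, of j] that by (simp add: A_def)
        qed
        then show ?thesis using h(2) by simp
      qed
      have xi: "y i \<in> derived_series (k i)" using yA[of i] i by (simp add: A_def)
      interpret Di: normal "derived_series (k i)" G by (rule derived_series_normal)
      have pow_in: "y i [^] n \<in> derived_series (k i)" for n :: nat
        by (induction n) (use xi in auto)
      have "ceval G t (y(i := y i [^] n)) = ceval G t y [^] n" for n :: nat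
      proof (induction n)
        case 0
        have "ceval G t (y(i := \<one>)) = \<one>" using yG i(1) by (intro ceval_eq_one) auto
        then show ?case by (simp only: nat_pow_0)
      next
        case (Suc n)
        then show ?case by (simp only: nat_pow_Suc linear[OF pow_in xi] fun_upd_triv)
      qed
      \<comment> \<open>By linearity this power is the value with \<open>y i [^] m\<close> in
        position \<open>i\<close>, which \<open>pow\<close> makes trivial.\<close>
      then have "ceval G t y [^] m = \<one>" using pow[OF yG i(1), of "y i"] yG by auto
      then have "torsion (ceval G t y)" using \<open>m > 0\<close> by (auto simp: torsion_def)
      then have "ceval G t y = \<one>" using torsion_free[OF yG] by blast
      moreover have "ceval G t y = ceval G t x" by (intro ceval_cong) (auto simp: y_def)
      ultimately show ?thesis by simp
    qed
  qed
  from this[of x "\<lambda>_. 0"] show ?thesis using x by auto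
qed

proposition finite_generate_outer_values:
  assumes t: "multilinear t" and N: "N \<lhd> G" "finite (rcosets N)"
    and marginal: "\<And>x i. x \<in> UNIV \<rightarrow> carrier G \<Longrightarrow> i \<in> vars t \<Longrightarrow> x i \<in> N \<Longrightarrow> ceval G t x = \<one>"
  shows "finite (generate G (outer_values t))"
proof -
  interpret N: normal N G by fact
  define H where "H = generate G (outer_values t)"
  have H: "H \<lhd> G" unfolding H_def by (rule generate_outer_values_normal)
  interpret H: normal H G by (rule H)
  have invariant: "ceval G t y = ceval G t x"
    if "x \<in> UNIV \<rightarrow> carrier G" "y \<in> UNIV \<rightarrow> carrier G" "\<And>i. i \<in> vars t \<Longrightarrow> y i \<in> N #> x i" for x y
    using that marginal by (intro ceval_coset_invariant[OF t N(1) order_refl]) auto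
  have finite_outer_values: "finite (outer_values t)"
    unfolding outer_values_def
  proof (rule finite_image_factor[where g = "\<lambda>x. restrict (\<lambda>i. N #> x i) (vars t)"])
    have "(\<lambda>x. restrict (\<lambda>i. N #> x i) (vars t)) ` (UNIV \<rightarrow> carrier G) \<subseteq> vars t \<rightarrow>\<^sub>E rcosets N"
      using rcosetsI[OF N.subset] by (auto simp: Pi_iff)
    then show "finite ((\<lambda>x. restrict (\<lambda>i. N #> x i) (vars t)) ` (UNIV \<rightarrow> carrier G))"
      using finite_PiE[OF finite_vars N(2)] finite_subset by blast
    fix x y assume x: "x \<in> UNIV \<rightarrow> carrier G" and y: "y \<in> UNIV \<rightarrow> carrier G"
      and eq: "restrict (\<lambda>i. N #> x i) (vars t) = restrict (\<lambda>i. N #> y i) (vars t)"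
    have "x i \<in> N #> y i" if "i \<in> vars t" for i
    proof -
      have "N #> x i = N #> y i" using fun_cong[OF eq, of i] that by simp
      then show ?thesis using x rcos_self[of "x i" N] N.subgroup_axioms by auto
    qed
    then show "ceval G t x = ceval G t y" by (intro invariant[OF y x])
  qed
  \<comment> \<open>Conjugating all arguments by \<open>n\<close> conjugates the value by
    \<open>n\<close>, yet it only multiplies each argument by an element of \<open>N\<close>, which
    leaves the value unchanged.\<close>
  have comm: "n \<otimes> v = v \<otimes> n" if n: "n \<in> N" and v: "v \<in> outer_values t" for n v
  proof -
    obtain x where x: "x \<in> UNIV \<rightarrow> carrier G" "v = ceval G t x"
      using v by (auto simp: outer_values_def)
    have xG: "x i \<in> carrier G" for i using x by auto
    have "conjugate n v = ceval G t (\<lambda>i. conjugate n (x i))"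
      using ceval_conjugate[OF x(1)] n x(2) by simp
    also have "\<dots> = v"
      unfolding x(2)
    proof (rule invariant[OF x(1)])
      show "(\<lambda>i. conjugate n (x i)) \<in> UNIV \<rightarrow> carrier G" using xG n by auto
      fix i
      have "conjugate n (x i) = (inv n \<otimes> conjugate (inv (x i)) n) \<otimes> x i"
        using xG n by (simp add: conjugate_def group_normalize)
      moreover have "inv n \<otimes> conjugate (inv (x i)) n \<in> N"
        using xG n normal_conjugate_closed[OF N(1)] by simp
      ultimately show "conjugate n (x i) \<in> N #> x i" by (auto simp: r_coset_def)
    qed
    finally have "n \<otimes> conjugate n v = n \<otimes> v" by simp
    then show ?thesis using n x by (simp add: conjugate_def m_assoc)
  qed
  have "h \<in> generate G (outer_values t) \<Longrightarrow> n \<otimes> h = h \<otimes> n" if n: "n \<in> N" for n h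
  proof (induction h rule: generate.induct)
    case one
    then show ?case using n by simp
  next
    case (incl h)
    then show ?case using comm n by blast
  next
    case (inv h)
    then have hG: "h \<in> carrier G" "n \<in> carrier G" using outer_values_closed n by auto
    have "inv h \<otimes> (n \<otimes> h) \<otimes> inv h = inv h \<otimes> (h \<otimes> n) \<otimes> inv h" using comm[OF n inv] by simp
    then show ?case using hG by (simp add: m_assoc)
  next
    case (eng h h')
    then have G: "h \<in> carrier G" "h' \<in> carrier G" "n \<in> carrier G"
      using generate_in_carrier[OF outer_values_closed] n by auto
    have "n \<otimes> (h \<otimes> h') = h \<otimes> n \<otimes> h'" using G eng.IH by (simp add: m_assoc[symmetric])
    then show ?case using G eng.IH by (simp add: m_assoc)
  qed
  then have centralizes: "n \<otimes> h = h \<otimes> n" if "n \<in> N" "h \<in> H" for n h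
    using that by (simp add: H_def)
  define R where "R = {h \<in> H. torsion h}"
  have R: "R \<lhd> G" unfolding R_def by (rule torsion_elements_normal[OF N H centralizes])
  interpret R: normal R G by (rule R)
  interpret Q: group "G Mod R" by (rule R.factorgroup_is_group)
  interpret \<pi>: group_hom G "G Mod R" "\<lambda>a. R #> a"
    by unfold_locales (rule R.r_coset_hom_Mod)
  obtain k where k: "derived_series k \<subseteq> H"
    using derived_series_subset_generate_outer_values[OF t] by (auto simp: H_def)
  have "derived_series (Suc k) \<subseteq> derived G H" using mono_derived[OF k] by simp
  also have "\<dots> \<subseteq> R"
    using derived_incl[OF order_refl H.subgroup_axioms]
      torsion_if_derived[OF N H centralizes] by (auto simp: R_def)
  finally have DR: "derived_series (Suc k) \<subseteq> R" .
  have surj: "carrier (G Mod R) = (\<lambda>a. R #> a) ` carrier G"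
    by (auto simp: FactGroup_def RCOSETS_def)
  have coset_one: "R #> a = \<one>\<^bsub>G Mod R\<^esub> \<longleftrightarrow> a \<in> R" if "a \<in> carrier G" for a
    using that coset_join1[of R a] coset_join2[of a R] R.subgroup_axioms by (auto simp: FactGroup_def)
  have lift: "\<exists>x \<in> UNIV \<rightarrow> carrier G. y = (\<lambda>i. R #> x i)" if "y \<in> UNIV \<rightarrow> carrier (G Mod R)" for y
  proof -
    have "\<forall>i. \<exists>a. a \<in> carrier G \<and> y i = R #> a" using that unfolding surj Pi_iff image_iff by blast
    then obtain x where "\<forall>i. x i \<in> carrier G \<and> y i = R #> x i" by metis
    then show ?thesis by (intro bexI[of _ x]) auto
  qed
  \<comment> \<open>\<open>H/R\<close> is torsion-free, because an element with a torsion power is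
    torsion. This supplies \<open>torsion_free\<close> in the quotient.\<close>
  have torsion_R: "a \<in> R" if a: "a \<in> H" "Q.torsion (R #> a)" for a
  proof -
    obtain n where n: "n > 0" "(R #> a) [^]\<^bsub>G Mod R\<^esub> (n :: nat) = \<one>\<^bsub>G Mod R\<^esub>"
      using a by (auto simp: Q.torsion_def)
    then have "R #> (a [^] n) = \<one>\<^bsub>G Mod R\<^esub>" using \<pi>.hom_nat_pow a by simp
    then have "a [^] n \<in> R" using coset_one a by simp
    then obtain l where "l > 0" "(a [^] n) [^] (l :: nat) = \<one>" by (auto simp: R_def torsion_def)
    then have "torsion a" unfolding torsion_def using n a
      by (intro exI[of _ "n * l"]) (simp add: nat_pow_pow)
    then show ?thesis using a by (simp add: R_def)
  qed
  have val_H: "ceval G t x \<in> H" if "x \<in> UNIV \<rightarrow> carrier G" for x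
    unfolding H_def using that by (intro generate.incl) (auto simp: outer_values_def)
  have "rcosets N \<noteq> {}" by (auto simp: RCOSETS_def)
  then have card_pos: "card (rcosets N) > 0" using N(2) by (simp add: card_gt_0_iff)
  have "torsion (ceval G t x)" if x: "x \<in> UNIV \<rightarrow> carrier G" for x
  proof -
    have "ceval (G Mod R) t (\<lambda>i. R #> x i) = \<one>\<^bsub>G Mod R\<^esub>"
    proof (rule Q.ceval_trivial_if_solvable[OF t _ card_pos])
      show "(derived (G Mod R) ^^ Suc k) (carrier (G Mod R)) \<subseteq> {\<one>\<^bsub>G Mod R\<^esub>}"
        unfolding surj \<pi>.exp_of_derived_img[OF order_refl]
        using DR coset_one R.mem_carrier by blast
      show "(\<lambda>i. R #> x i) \<in> UNIV \<rightarrow> carrier (G Mod R)" using x \<pi>.hom_closed by blast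
    next
      fix y :: "nat \<Rightarrow> 'a set"
      assume "y \<in> UNIV \<rightarrow> carrier (G Mod R)" "Q.torsion (ceval (G Mod R) t y)"
      then obtain x :: "nat \<Rightarrow> 'a" where x: "x \<in> UNIV \<rightarrow> carrier G" "y = (\<lambda>i. R #> x i)"
          "Q.torsion (ceval (G Mod R) t y)"
        using lift by blast
      then show "ceval (G Mod R) t y = \<one>\<^bsub>G Mod R\<^esub>"
        using torsion_R[OF val_H[OF x(1)]] coset_one \<pi>.ceval_hom[OF x(1)] by simp
    next
      fix y :: "nat \<Rightarrow> 'a set" and i g
      assume y: "y \<in> UNIV \<rightarrow> carrier (G Mod R)" and i: "i \<in> vars t" and "g \<in> carrier (G Mod R)"
      then obtain a where a: "a \<in> carrier G" "g = R #> a" unfolding surj by blast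
      obtain x :: "nat \<Rightarrow> 'a" where x: "x \<in> UNIV \<rightarrow> carrier G" "y = (\<lambda>i. R #> x i)"
        using lift[OF y] by blast
      let ?m = "card (rcosets N)"
      have xa: "x(i := a [^] ?m) \<in> UNIV \<rightarrow> carrier G" using x a by auto
      have "y(i := g [^]\<^bsub>G Mod R\<^esub> ?m) = (\<lambda>j. R #> (x(i := a [^] ?m)) j)"
        using \<pi>.hom_nat_pow[OF a(1), of ?m] unfolding x(2) a(2) by (intro ext) simp
      then have "ceval (G Mod R) t (y(i := g [^]\<^bsub>G Mod R\<^esub> ?m)) = R #> ceval G t (x(i := a [^] ?m))"
        using \<pi>.ceval_hom[OF xa] by simp
      \<comment> \<open>The exponent is the index of \<open>N\<close>, so the power lies in
        \<open>N\<close> and kills the value already in \<open>G\<close>.\<close>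
      also have "ceval G t (x(i := a [^] ?m)) = \<one>"
        using xa i pow_index_mem[OF N a(1)] by (intro marginal[OF xa i]) auto
      also have "R #> \<one> = \<one>\<^bsub>G Mod R\<^esub>" by (rule \<pi>.hom_one)
      finally show "ceval (G Mod R) t (y(i := g [^]\<^bsub>G Mod R\<^esub> ?m)) = \<one>\<^bsub>G Mod R\<^esub>" .
    qed
    then have "ceval G t x \<in> R" using \<pi>.ceval_hom[OF x] coset_one x by simp
    then show ?thesis by (simp add: R_def)
  qed
  then show ?thesis
    using finite_outer_values outer_values_closed conjugate_outer_values
    by (intro finite_generate_if_torsion) (auto simp: outer_values_def)
qed

end

section \<open>Profinite groups\<close>

context topological_group
begin

lemma carrier_open [simp]: "openin T (carrier G)"
  using openin_topspace[of T] by (simp add: topspace_eq_carrier)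

lemma continuous_map_mult:
  assumes "continuous_map X T f" "continuous_map X T g"
  shows "continuous_map X T (\<lambda>x. f x \<otimes> g x)"
  using continuous_map_compose[OF continuous_map_pairedI[OF assms] continuous_mult]
  by (simp add: comp_def)

lemma continuous_map_inv:
  assumes "continuous_map X T f"
  shows "continuous_map X T (\<lambda>x. inv f x)"
  using continuous_map_compose[OF assms continuous_inv] by (simp add: comp_def)

lemma continuous_map_const_carrier: "a \<in> carrier G \<Longrightarrow> continuous_map X T (\<lambda>_. a)"
  by (simp add: topspace_eq_carrier)

lemma continuous_map_ceval: "continuous_map (product_topology (\<lambda>_. T) UNIV) T (ceval G t)"
proof (induction t)
  case (Var i)
  have "ceval G (Var i) = (\<lambda>x. x i)" by auto
  then show ?case using continuous_map_product_projection[of i UNIV "\<lambda>_. T"] by simp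
next
  case (Comm s t)
  have "ceval G (Comm s t) = (\<lambda>x. inv (ceval G s x) \<otimes> inv (ceval G t x) \<otimes> ceval G s x \<otimes> ceval G t x)"
    by (auto simp: commutator_def)
  then show ?case using Comm by (simp add: continuous_map_mult continuous_map_inv)
qed

lemma openin_left_translate:
  assumes "openin T U" "a \<in> carrier G"
  shows "openin T {x \<in> carrier G. a \<otimes> x \<in> U}"
proof -
  have "continuous_map T T (\<lambda>x. a \<otimes> x)"
    using continuous_map_mult[OF continuous_map_const_carrier[OF assms(2)]
        continuous_map_id[unfolded id_def]] .
  from openin_continuous_map_preimage[OF this assms(1)] show ?thesis
    by (simp add: topspace_eq_carrier)
qed

lemma openin_right_translate:
  assumes "openin T U" "a \<in> carrier G"
  shows "openin T {x \<in> carrier G. x \<otimes> a \<in> U}"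
proof -
  have "continuous_map T T (\<lambda>x. x \<otimes> a)"
    using continuous_map_mult[OF continuous_map_id[unfolded id_def]
        continuous_map_const_carrier[OF assms(2)]] .
  from openin_continuous_map_preimage[OF this assms(1)] show ?thesis
    by (simp add: topspace_eq_carrier)
qed

lemma openin_subgroup:
  assumes "subgroup H G" "openin T V" "\<one> \<in> V" "V \<subseteq> H"
  shows "openin T H"
  unfolding openin_subopen[of T H]
proof
  fix h assume h: "h \<in> H"
  interpret H: subgroup H G by fact
  let ?V = "{x \<in> carrier G. inv h \<otimes> x \<in> V}"
  have "x \<in> H" if x: "x \<in> ?V" for x
  proof -
    have "h \<otimes> (inv h \<otimes> x) \<in> H" using x h assms(4) by blast
    then show ?thesis using x h by simp
  qed
  moreover have "openin T ?V" using h assms(2) by (intro openin_left_translate) auto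
  moreover have "h \<in> ?V" using h assms(3) by simp
  ultimately show "\<exists>U. openin T U \<and> h \<in> U \<and> U \<subseteq> H"
    by blast
qed

lemma openin_rcoset:
  assumes "subgroup H G" "openin T H" "C \<in> rcosets H"
  shows "openin T C"
proof -
  obtain a where a: "a \<in> carrier G" "C = H #> a" using assms(3) by (auto simp: RCOSETS_def)
  then have "C = {x \<in> carrier G. x \<otimes> inv a \<in> H}"
    using subgroup.rcos_module[OF assms(1) is_group a(1)] r_coset_subset_G[OF _ a(1), of H]
      subgroup.subset[OF assms(1)] by blast
  then show ?thesis using openin_right_translate[OF assms(2)] a by simp
qed

definition open_normal :: "'a set \<Rightarrow> bool" where
  "open_normal N \<longleftrightarrow> N \<lhd> G \<and> openin T N"

lemma open_normal_below_finite:
  assumes "finite I" "\<And>i. i \<in> I \<Longrightarrow> open_normal (L i)"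
  obtains M where "open_normal M" "\<And>i. i \<in> I \<Longrightarrow> M \<subseteq> L i"
proof -
  have "\<exists>M. open_normal M \<and> (\<forall>i \<in> I. M \<subseteq> L i)"
    using assms
  proof (induction I rule: finite_induct)
    case empty
    then show ?case using normal_self by (auto simp: open_normal_def)
  next
    case (insert j I)
    then obtain M where "open_normal M" "\<forall>i \<in> I. M \<subseteq> L i" by auto
    then have "open_normal (M \<inter> L j)" "\<forall>i \<in> insert j I. M \<inter> L j \<subseteq> L i"
      using insert.prems[of j] normal_subgroup_intersect by (auto simp: open_normal_def)
    then show ?case by blast
  qed
  then show thesis using that by blast
qed

lemma finite_rcosets_open:
  assumes "compact_space T" "subgroup H G" "openin T H"
  shows "finite (rcosets H)"
proof -
  have "\<exists>\<F>. finite \<F> \<and> \<F> \<subseteq> rcosets H \<and> \<Union>\<F> = topspace T"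
    using assms(1)[unfolded compact_space] openin_rcoset[OF assms(2,3)] rcosets_part_G[OF assms(2)]
    by (simp add: topspace_eq_carrier)
  then obtain \<F> where \<F>: "finite \<F>" "\<F> \<subseteq> rcosets H" "\<Union>\<F> = carrier G"
    by (auto simp: topspace_eq_carrier)
  have "rcosets H \<subseteq> \<F>"
  proof
    fix C assume C: "C \<in> rcosets H"
    then obtain a where a: "a \<in> carrier G" "C = H #> a" by (auto simp: RCOSETS_def)
    then have "a \<in> C" using rcos_self assms(2) by blast
    obtain D where D: "D \<in> \<F>" "a \<in> D" using \<F>(3) a(1) by blast
    then obtain b where b: "b \<in> carrier G" "D = H #> b" using \<F>(2) by (auto simp: RCOSETS_def)
    then have "D = H #> a" using D repr_independence assms(2) by blast
    then show "C \<in> \<F>" using a D by simp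
  qed
  then show ?thesis using \<F>(1) finite_subset by blast
qed

end

context profinite_group
begin

text \<open>If \<open>C\<close> is a clopen neighbourhood of the identity, the elements all of whose conjugates
  stabilise \<open>C\<close> under right multiplication form a normal subgroup inside \<open>C\<close>; it is open by the
  tube lemma.\<close>

lemma open_normal_basis:
  assumes "openin T U" "\<one> \<in> U"
  obtains N where "open_normal N" "N \<subseteq> U"
proof -
  obtain C where C: "openin T C" "closedin T C" "\<one> \<in> C" "C \<subseteq> U"
    using clopen_neighbourhood[OF compact Hausdorff totally_disconnected assms] by blast
  define N where "N = {g \<in> carrier G. \<forall>x \<in> carrier G. \<forall>c \<in> carrier G.
    c \<otimes> (x \<otimes> g \<otimes> inv x) \<in> C \<longleftrightarrow> c \<in> C}"
  have NI: "g \<in> N" if "g \<in> carrier G" "\<And>x c. x \<in> carrier G \<Longrightarrow> c \<in> carrier G \<Longrightarrow>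
      c \<otimes> (x \<otimes> g \<otimes> inv x) \<in> C \<longleftrightarrow> c \<in> C" for g
    using that by (simp add: N_def)
  have ND: "g \<in> carrier G" "x \<in> carrier G \<Longrightarrow> c \<in> carrier G \<Longrightarrow>
      c \<otimes> (x \<otimes> g \<otimes> inv x) \<in> C \<longleftrightarrow> c \<in> C" if "g \<in> N" for g x c
    using that by (simp_all add: N_def)
  have subgroup: "subgroup N G"
  proof (rule subgroupI)
    show "N \<subseteq> carrier G" by (auto simp: N_def)
    have "\<one> \<in> N" by (intro NI) auto
    then show "N \<noteq> {}" by blast
  next
    fix g assume g: "g \<in> N"
    note gG = ND(1)[OF g]
    show "inv g \<in> N"
    proof (rule NI)
      fix x c assume xc: "x \<in> carrier G" "c \<in> carrier G"
      then have "c \<otimes> (x \<otimes> inv g \<otimes> inv x) \<otimes> (x \<otimes> g \<otimes> inv x) = c"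
        using gG by (simp add: group_normalize)
      then show "c \<otimes> (x \<otimes> inv g \<otimes> inv x) \<in> C \<longleftrightarrow> c \<in> C"
        using ND(2)[OF g xc(1), of "c \<otimes> (x \<otimes> inv g \<otimes> inv x)"] xc gG by simp
    qed (use gG in simp)
  next
    fix g h assume g: "g \<in> N" and h: "h \<in> N"
    note G = ND(1)[OF g] ND(1)[OF h]
    show "g \<otimes> h \<in> N"
    proof (rule NI)
      fix x c assume xc: "x \<in> carrier G" "c \<in> carrier G"
      then have "c \<otimes> (x \<otimes> (g \<otimes> h) \<otimes> inv x) = c \<otimes> (x \<otimes> g \<otimes> inv x) \<otimes> (x \<otimes> h \<otimes> inv x)"
        using G by (simp add: group_normalize)
      then show "c \<otimes> (x \<otimes> (g \<otimes> h) \<otimes> inv x) \<in> C \<longleftrightarrow> c \<in> C"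
        using ND(2)[OF h xc(1), of "c \<otimes> (x \<otimes> g \<otimes> inv x)"] ND(2)[OF g xc] xc G by simp
    qed (use G in simp)
  qed
  have normal: "N \<lhd> G"
  proof (rule normal_invI[OF subgroup])
    fix y g assume y: "y \<in> carrier G" and g: "g \<in> N"
    note gG = ND(1)[OF g]
    show "y \<otimes> g \<otimes> inv y \<in> N"
    proof (rule NI)
      fix x c assume xc: "x \<in> carrier G" "c \<in> carrier G"
      then have "x \<otimes> (y \<otimes> g \<otimes> inv y) \<otimes> inv x = (x \<otimes> y) \<otimes> g \<otimes> inv (x \<otimes> y)"
        using y gG by (simp add: group_normalize)
      then show "c \<otimes> (x \<otimes> (y \<otimes> g \<otimes> inv y) \<otimes> inv x) \<in> C \<longleftrightarrow> c \<in> C"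
        using ND(2)[OF g, of "x \<otimes> y" c] xc y by simp
    qed (use y gG in simp)
  qed
  have "N \<subseteq> C"
  proof
    fix g assume "g \<in> N"
    from ND(2)[OF this, of \<one> \<one>] ND(1)[OF this] show "g \<in> C" using C(3) by simp
  qed
  moreover have "openin T N"
  proof -
    let ?X = "prod_topology T T" and ?f = "\<lambda>p. snd (fst p) \<otimes> (fst (fst p) \<otimes> snd p \<otimes> inv (fst (fst p)))"
    let ?P = "prod_topology ?X T"
    have proj: "continuous_map ?P T (\<lambda>p. snd p)" "continuous_map ?P T (\<lambda>p. fst (fst p))"
      "continuous_map ?P T (\<lambda>p. snd (fst p))"
      using continuous_map_snd[of ?X T] continuous_map_compose[OF continuous_map_fst[of ?X T] continuous_map_fst]
        continuous_map_compose[OF continuous_map_fst[of ?X T] continuous_map_snd]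
      by (simp_all add: comp_def)
    have f: "continuous_map ?P T ?f"
      using proj by (intro continuous_map_mult continuous_map_inv)
    \<comment> \<open>The triples for which multiplying \<open>c\<close> by the conjugate of
      \<open>g\<close> does not alter membership in \<open>C\<close>. The set is open because
      \<open>C\<close> is clopen, and it contains the slice \<open>g = \<one>\<close> over the
      compact space of pairs \<open>(x, c)\<close>.\<close>
    define W where "W = {p \<in> topspace ?P. ?f p \<in> C} \<inter> {p \<in> topspace ?P. snd (fst p) \<in> C} \<union>
      {p \<in> topspace ?P. ?f p \<in> topspace T - C} \<inter> {p \<in> topspace ?P. snd (fst p) \<in> topspace T - C}"
    have C': "openin T (topspace T - C)" using C(2) by blast
    have "openin ?P W"
      unfolding W_def
      by (intro openin_Un openin_Int openin_continuous_map_preimage[OF f]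
          openin_continuous_map_preimage[OF proj(3)] C(1) C')
    moreover have "compactin ?X (topspace ?X)"
      using compact unfolding compact_space_def[symmetric] by (simp add: compact_space_prod_topology)
    moreover have "\<one> \<in> topspace T" by (simp add: topspace_eq_carrier)
    moreover have "topspace ?X \<times> {\<one>} \<subseteq> W"
      by (auto simp: W_def topspace_eq_carrier)
    ultimately obtain A V where V: "openin T V" "\<one> \<in> V" "topspace ?X \<subseteq> A" "A \<times> V \<subseteq> W"
      using tube_lemma_left[of ?X T W "topspace ?X" \<one>] by blast
    have "V \<subseteq> N"
    proof
      fix g assume g: "g \<in> V"
      show "g \<in> N"
      proof (rule NI)
        show "g \<in> carrier G" using V(1) g openin_subset topspace_eq_carrier by blast
        fix x c assume "x \<in> carrier G" "c \<in> carrier G"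
        then have "(x, c) \<in> topspace ?X" by (simp add: topspace_eq_carrier)
        then have "((x, c), g) \<in> W" using V(3,4) g by blast
        then show "c \<otimes> (x \<otimes> g \<otimes> inv x) \<in> C \<longleftrightarrow> c \<in> C" by (auto simp: W_def)
      qed
    qed
    then show ?thesis using openin_subgroup[OF subgroup V(1,2)] by blast
  qed
  ultimately show thesis using that[of N] normal C(4) by (auto simp: open_normal_def)
qed

text \<open>The product of copies of \<open>T\<close> is compact and Hausdorff, so the word is
  constant near some \<open>y\<close> in \<open>U\<close>. Only the finitely many coordinates in
  \<open>vars t\<close> affect it, so one open normal \<open>M\<close> is small enough for all of
  them.\<close>

lemma ceval_constant_on_open_cosets:
  assumes few: "outer_values t \<prec> (UNIV :: nat set set)"
    and U: "openin (product_topology (\<lambda>_. T) UNIV) U" "U \<noteq> {}" and N: "open_normal N"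
  shows "\<exists>y \<in> U. \<exists>M c. open_normal M \<and> M \<subseteq> N \<and> (\<forall>x \<in> coset_class t M y {}. ceval G t x = c)"
proof -
  let ?X = "product_topology (\<lambda>_ :: nat. T) UNIV"
  have top: "topspace ?X = UNIV \<rightarrow> carrier G" by (auto simp: topspace_eq_carrier)
  have X: "compact_space ?X" "Hausdorff_space ?X"
    using compact Hausdorff by (simp_all add: compact_space_product_topology Hausdorff_space_product_topology)
  have UG: "U \<subseteq> UNIV \<rightarrow> carrier G" using U(1) openin_subset top by blast
  have "\<not> (UNIV :: nat set set) \<lesssim> ceval G t ` U"
  proof
    assume "(UNIV :: nat set set) \<lesssim> ceval G t ` U"
    moreover have "ceval G t ` U \<subseteq> outer_values t" using UG by (auto simp: outer_values_def)
    ultimately have "(UNIV :: nat set set) \<lesssim> outer_values t"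
      using lepoll_trans subset_imp_lepoll by blast
    then show False using few lepoll_antisym by (auto simp: lesspoll_def)
  qed
  then have "\<exists>V c. openin ?X V \<and> V \<noteq> {} \<and> V \<subseteq> U \<and> (\<forall>x\<in>V. ceval G t x = c)"
    by (rule continuous_constant_on_open[OF X(1) compact_Hausdorff_imp_regular_space[OF X]
        continuous_map_ceval Hausdorff U])
  then obtain V c where V: "openin ?X V" "V \<noteq> {}" "V \<subseteq> U" "\<And>x. x \<in> V \<Longrightarrow> ceval G t x = c"
    by blast
  then obtain y where y: "y \<in> V" by blast
  then have yG: "y i \<in> carrier G" for i using UG V(3) by blast
  obtain B where "\<forall>i \<in> UNIV. openin T (B i)" "y \<in> PiE UNIV B" and B_V: "PiE UNIV B \<subseteq> V"
    using bspec[OF V(1)[unfolded openin_product_topology_alt] y] by (elim exE conjE) rule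
  then have B: "openin T (B i)" "y i \<in> B i" for i
    by (auto simp: PiE_UNIV_domain)
  have "\<exists>M. open_normal M \<and> M \<subseteq> {g \<in> carrier G. y i \<otimes> g \<in> B i}" for i
  proof -
    have "\<one> \<in> {g \<in> carrier G. y i \<otimes> g \<in> B i}" using B(2) yG by simp
    from open_normal_basis[OF openin_left_translate[OF B(1) yG] this] show ?thesis by blast
  qed
  then obtain L where L: "\<And>i. open_normal (L i)" "\<And>i. L i \<subseteq> {g \<in> carrier G. y i \<otimes> g \<in> B i}"
    by metis
  have fin: "finite (insert N (L ` vars t))" by simp
  have open_normals: "open_normal K" if "K \<in> insert N (L ` vars t)" for K
    using that N L(1) by auto
  obtain M where M: "open_normal M" "\<And>K. K \<in> insert N (L ` vars t) \<Longrightarrow> M \<subseteq> K"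
    using open_normal_below_finite[where L = "\<lambda>K. K", OF fin open_normals] by blast
  have "ceval G t x = c" if x: "x \<in> coset_class t M y {}" for x
  proof -
    \<comment> \<open>\<open>coset_class\<close> leaves coordinates outside \<open>vars t\<close>
      free; they are reset to those of \<open>y\<close> to enter the box \<open>B\<close>.\<close>
    define x' where "x' i = (if i \<in> vars t then x i else y i)" for i
    have "x' i \<in> B i" for i
    proof (cases "i \<in> vars t")
      case True
      then have "x i \<in> y i <# M" using x by (auto simp: coset_class_def)
      then obtain m where m: "m \<in> M" "x i = y i \<otimes> m" by (auto simp: l_coset_def)
      then have "m \<in> L i" using M(2)[of "L i"] True by blast
      then show ?thesis using True m L(2)[of i] by (auto simp: x'_def)
    qed (use B in \<open>simp add: x'_def\<close>)
    then have "ceval G t x' = c" using B_V by (intro V(4)) auto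
    moreover have "ceval G t x' = ceval G t x" by (intro ceval_cong) (simp add: x'_def)
    ultimately show ?thesis by simp
  qed
  moreover have "y \<in> U" using y V(3) by blast
  moreover have "M \<subseteq> N" using M(2) by simp
  ultimately show ?thesis
    using M(1) by (intro bexI[of _ y] exI[of _ M] exI[of _ c]) auto
qed

text \<open>By induction on the set \<open>I\<close> of unrestricted arguments: on every coset of the arguments in \<open>I\<close>
  the word is constant on some smaller box, hence trivial there as soon as the other arguments are
  small, and the induction hypothesis makes this independent of the representatives.\<close>

lemma ceval_trivial_on_open_normal:
  assumes t: "multilinear t" and few: "outer_values t \<prec> (UNIV :: nat set set)"
    and "I \<subset> vars t"
  shows "\<exists>N. open_normal N \<and>
    (\<forall>x \<in> UNIV \<rightarrow> carrier G. (\<forall>j \<in> vars t - I. x j \<in> N) \<longrightarrow> ceval G t x = \<one>)"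
proof -
  have "finite I" using assms(3) finite_subset[OF _ finite_vars] by blast
  then show ?thesis
    using assms(3)
  proof (induction I rule: finite_psubset_induct)
    case (psubset I)
    \<comment> \<open>For \<open>I - {i}\<close> the argument \<open>i\<close> joins the small ones.
      Intersecting over \<open>i\<close> gives one \<open>M\<close> modulo which the arguments in
      \<open>I\<close> matter, as long as the others lie in \<open>M\<close>.\<close>
    have "\<exists>N. open_normal N \<and> (\<forall>x \<in> UNIV \<rightarrow> carrier G.
        (\<forall>j \<in> vars t - (I - {i}). x j \<in> N) \<longrightarrow> ceval G t x = \<one>)" if "i \<in> I" for i
      using that psubset.prems by (intro psubset.IH) auto
    then obtain L where L: "\<And>i. i \<in> I \<Longrightarrow> open_normal (L i)"
        "\<And>i x. i \<in> I \<Longrightarrow> x \<in> UNIV \<rightarrow> carrier G \<Longrightarrow> (\<forall>j \<in> vars t - (I - {i}). x j \<in> L i) \<Longrightarrow>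
          ceval G t x = \<one>"
      by metis
    obtain M where M: "open_normal M" "\<And>i. i \<in> I \<Longrightarrow> M \<subseteq> L i"
      using open_normal_below_finite[where L = L, OF psubset.hyps L(1)] by blast
    then interpret M: normal M G by (simp add: open_normal_def)
    have M_one: "ceval G t x = \<one>"
      if "i \<in> I" "x \<in> UNIV \<rightarrow> carrier G" "\<And>j. j \<in> insert i (vars t - I) \<Longrightarrow> x j \<in> M" for i x
      using that M(2) psubset.prems by (intro L(2)[of i]) auto
    have fin: "finite (rcosets M)"
      using M(1) finite_rcosets_open[OF compact M.subgroup_axioms] by (simp add: open_normal_def)
    \<comment> \<open>\<open>\<rho>\<close> fixes a coset of \<open>M\<close> for each unrestricted
      argument. There are finitely many \<open>\<rho>\<close>, so the subgroups \<open>K\<close>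
      found for each can be intersected.\<close>
    have "\<exists>K. open_normal K \<and> (\<forall>x \<in> UNIV \<rightarrow> carrier G. (\<forall>i \<in> I. x i \<in> \<rho> i) \<longrightarrow>
        (\<forall>j \<in> vars t - I. x j \<in> K) \<longrightarrow> ceval G t x = \<one>)" if \<rho>: "\<rho> \<in> I \<rightarrow>\<^sub>E rcosets M" for \<rho>
    proof -
      let ?S = "\<lambda>i. if i \<in> I then \<rho> i else if i \<in> vars t then M else carrier G"
      have S: "openin T (?S i)" "?S i \<noteq> {}" for i
      proof -
        have "openin T (\<rho> i) \<and> \<rho> i \<noteq> {}" if "i \<in> I"
        proof -
          have "\<rho> i \<in> rcosets M" using \<rho> that by auto
          then show ?thesis
            using openin_rcoset[OF M.subgroup_axioms] M.rcosets_non_empty M(1)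
            unfolding open_normal_def by blast
        qed
        moreover have "M \<noteq> {}" "carrier G \<noteq> {}" using M.one_closed one_closed by blast+
        ultimately show "openin T (?S i)" "?S i \<noteq> {}"
          using M(1) by (auto simp: open_normal_def)
      qed
      have "{i \<in> UNIV. ?S i \<noteq> topspace T} \<subseteq> I \<union> vars t" by (auto simp: topspace_eq_carrier)
      then have "finite {i \<in> UNIV. ?S i \<noteq> topspace T}"
        using psubset.hyps finite_subset[OF _ finite_UnI[OF _ finite_vars]] by blast
      then have openin_S: "openin (product_topology (\<lambda>_. T) UNIV) (PiE UNIV ?S)"
        using S(1) unfolding openin_PiE_gen by blast
      have S_nonempty: "PiE UNIV ?S \<noteq> {}" using S(2) by (simp only: PiE_eq_empty_iff) blast
      obtain y K c where y: "y \<in> PiE UNIV ?S" and K: "open_normal K" "K \<subseteq> M"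
          and const: "\<And>x. x \<in> coset_class t K y {} \<Longrightarrow> ceval G t x = c"
        using ceval_constant_on_open_cosets[OF few openin_S S_nonempty M(1)]
        by fast
      have y_in: "y i \<in> ?S i" for i using y by (rule PiE_mem) simp
      have yG: "y i \<in> carrier G" for i using y_in[of i] S(1)[of i] openin_subset topspace_eq_carrier by blast
      interpret K: normal K G using K(1) by (simp add: open_normal_def)
      have "ceval G t x = \<one>"
        if x: "x \<in> UNIV \<rightarrow> carrier G" "\<forall>i \<in> I. x i \<in> \<rho> i" "\<forall>j \<in> vars t - I. x j \<in> K" for x
      proof -
        \<comment> \<open>The arguments in \<open>I\<close> are replaced by those of
          \<open>y\<close>, which lie in the same cosets of \<open>M\<close>. The value does not
          change, and constancy on the box around \<open>y\<close> forces it to be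
          \<open>\<one>\<close>.\<close>
        define z where "z i = (if i \<in> I then y i else x i)" for i
        have zG: "z \<in> UNIV \<rightarrow> carrier G" using x(1) yG by (auto simp: z_def)
        have "y i \<in> y i <# K" for i
          using mem_l_coset_iff[OF K.subgroup_axioms yG yG] yG by simp
        then have "z \<in> coset_class t K y (vars t - I)"
          using zG x(3) by (auto simp: coset_class_def z_def)
        moreover have "vars t - I \<subseteq> vars t" "vars t - I \<noteq> {}" using psubset.prems by auto
        ultimately have "ceval G t z = \<one>"
          using ceval_constant_on_cosets[OF t K.normal_axioms _ const] yG by blast
        moreover have "ceval G t x = ceval G t z"
        proof (rule ceval_coset_invariant[OF t M.normal_axioms, where I = I])
          show "I \<subseteq> vars t" using psubset.prems by blast
          show "z j \<in> M" if "j \<in> vars t - I" for j using that x(3) K(2) by (auto simp: z_def)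
          show "z j = x j" if "j \<in> vars t - I" for j using that by (auto simp: z_def)
          show "x i \<in> M #> z i" if i: "i \<in> I" for i
          proof -
            have "\<rho> i \<in> rcosets M" using \<rho> i by auto
            then obtain a where a: "a \<in> carrier G" "\<rho> i = M #> a" by (auto simp: RCOSETS_def)
            have "y i \<in> M #> a" using y_in[of i] i a by simp
            then have "M #> a = M #> y i" using repr_independence a(1) M.subgroup_axioms by blast
            moreover have "x i \<in> \<rho> i" using x(2) i by blast
            ultimately show ?thesis using i a(2) by (simp add: z_def)
          qed
        qed (use x zG M_one in auto)
        ultimately show ?thesis by simp
      qed
      then show ?thesis using K(1) by blast
    qed
    then obtain K where K: "\<And>\<rho>. \<rho> \<in> I \<rightarrow>\<^sub>E rcosets M \<Longrightarrow> open_normal (K \<rho>)"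
        "\<And>\<rho> x. \<rho> \<in> I \<rightarrow>\<^sub>E rcosets M \<Longrightarrow> x \<in> UNIV \<rightarrow> carrier G \<Longrightarrow> \<forall>i \<in> I. x i \<in> \<rho> i \<Longrightarrow>
          \<forall>j \<in> vars t - I. x j \<in> K \<rho> \<Longrightarrow> ceval G t x = \<one>"
      by metis
    have finite_PiE: "finite (I \<rightarrow>\<^sub>E rcosets M)" using psubset.hyps fin by (intro finite_PiE) auto
    obtain N where N: "open_normal N" "\<And>\<rho>. \<rho> \<in> I \<rightarrow>\<^sub>E rcosets M \<Longrightarrow> N \<subseteq> K \<rho>"
      using open_normal_below_finite[where L = K, OF finite_PiE K(1)] by blast
    have "ceval G t x = \<one>"
      if x: "x \<in> UNIV \<rightarrow> carrier G" "\<forall>j \<in> vars t - I. x j \<in> N" for x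
    proof (rule K(2))
      let ?\<rho> = "restrict (\<lambda>i. M #> x i) I"
      show \<rho>: "?\<rho> \<in> I \<rightarrow>\<^sub>E rcosets M" using x(1) rcosetsI[OF M.subset] by auto
      show "\<forall>i \<in> I. x i \<in> ?\<rho> i" using x(1) rcos_self[OF _ M.subgroup_axioms] by auto
      show "\<forall>j \<in> vars t - I. x j \<in> K ?\<rho>" using N(2)[OF \<rho>] x(2) by blast
    qed (rule x(1))
    then show ?case using N(1) by blast
  qed
qed

proposition finite_generate_outer_values_profinite:
  assumes t: "multilinear t" and few: "outer_values t \<prec> (UNIV :: nat set set)"
  shows "finite (generate G (outer_values t))"
proof -
  have "\<exists>N. open_normal N \<and> (\<forall>x \<in> UNIV \<rightarrow> carrier G. x i \<in> N \<longrightarrow> ceval G t x = \<one>)"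
    if "i \<in> vars t" for i
  proof -
    \<comment> \<open>All arguments but the \<open>i\<close>-th are unrestricted, so a single small
      argument is enough.\<close>
    have "vars t - {i} \<subset> vars t" "vars t - (vars t - {i}) = {i}" using that by auto
    then show ?thesis using ceval_trivial_on_open_normal[OF t few, of "vars t - {i}"] by auto
  qed
  then obtain L where L: "\<And>i. i \<in> vars t \<Longrightarrow> open_normal (L i)"
      "\<And>i x. i \<in> vars t \<Longrightarrow> x \<in> UNIV \<rightarrow> carrier G \<Longrightarrow> x i \<in> L i \<Longrightarrow> ceval G t x = \<one>"
    by metis
  obtain N where N: "open_normal N" "\<And>i. i \<in> vars t \<Longrightarrow> N \<subseteq> L i"
    using open_normal_below_finite[where L = L, OF finite_vars L(1)] by blast
  then have "N \<lhd> G" "openin T N" by (simp_all add: open_normal_def)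
  moreover from this have "finite (rcosets N)"
    using normal_imp_subgroup by (intro finite_rcosets_open[OF compact]) auto
  ultimately show ?thesis using finite_generate_outer_values[OF t] L(2) N(2) by blast
qed

end

theorem theorem1p1:
  fixes r :: nat and w :: "letter list"
    and G :: "('a, 'm) monoid_scheme" and T :: "'a topology"
  assumes "w \<in> carrier (free_group {1..r})"
    and "multilinear_commutator_word w"
    and "profinite_group G T"
    and "word_values G r w \<prec> (UNIV :: nat set set)"
  shows "finite (verbal_subgroup G T r w)"
proof -
  interpret profinite_group G T by fact
  obtain t where t: "multilinear t" "vars t = fst ` set w"
      "\<And>g. g \<in> UNIV \<rightarrow> carrier G \<Longrightarrow> word_eval G g w = ceval G t g"
    using multilinear_commutator_word_ceval[OF assms(2)] by blast
  have vars: "fst ` set w \<subseteq> {1..r}" using assms(1) by (simp add: free_group_def)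
  have "word_values G r w = outer_values t"
  proof (intro equalityI subsetI)
    fix a assume "a \<in> word_values G r w"
    then obtain g where g: "g \<in> {1..r} \<rightarrow> carrier G" "a = word_eval G g w"
      by (auto simp: word_values_def)
    \<comment> \<open>\<open>ceval\<close> works with total assignments; the default
      \<open>\<one>\<close> fills indices that do not occur in \<open>w\<close>.\<close>
    let ?g = "\<lambda>i. if i \<in> {1..r} then g i else \<one>\<^bsub>G\<^esub>"
    have "a = word_eval G ?g w" using g(2) vars by (auto intro!: word_eval_cong)
    moreover have "?g \<in> UNIV \<rightarrow> carrier G" using g(1) by auto
    ultimately show "a \<in> outer_values t" using t(3) by (auto simp: outer_values_def)
  next
    fix a assume "a \<in> outer_values t"
    then obtain g where g: "g \<in> UNIV \<rightarrow> carrier G" "a = ceval G t g"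
      by (auto simp: outer_values_def)
    then have "a = word_eval G g w" "g \<in> {1..r} \<rightarrow> carrier G" using t(3) by auto
    then show "a \<in> word_values G r w" by (auto simp: word_values_def)
  qed
  note word_values = this
  let ?H = "generate G (outer_values t)"
  have "finite ?H"
    using finite_generate_outer_values_profinite[OF t(1)] assms(4) word_values by simp
  moreover have "subgroup ?H G" using generate_is_subgroup[OF outer_values_closed] .
  \<comment> \<open>A finite set is closed in a Hausdorff space, so \<open>?H\<close> is one of the
    subgroups intersected in \<open>closed_subgroup_generated\<close>.\<close>
  moreover have "closedin T ?H"
    using closedin_Hausdorff_finite[OF Hausdorff _ \<open>finite ?H\<close>] generate_incl[OF outer_values_closed]
    by (simp add: topspace_eq_carrier)
  moreover have "outer_values t \<subseteq> ?H" by (auto intro: generate.incl)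
  ultimately have "verbal_subgroup G T r w \<subseteq> ?H"
    unfolding verbal_subgroup_def closed_subgroup_generated_def word_values by blast
  then show ?thesis using \<open>finite ?H\<close> finite_subset by blast
qed

end
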